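(* Let $\mathbf w\in\mathbb{Z}^n\setminus\{0\}$ be a parabolic weight vector, let $z\ge1$ be the number of indices $i$ with $w_i=0$, and suppose the nonzero weights of $\mathbf w$ are all of the same sign. Then $\mathcal{K}(n,\mathbf w)\ne\emptyset$ if and only if the Jacobian Conjecture fails in dimension $z$. In particular $\mathcal{K}(n,\mathbf w)=\emptyset$ when $z=1$.
   Context: All varieties are over $\mathbb{C}$. A weight vector $\mathbf w=(w_1,\dots,w_n)$ grades $\mathbb{C}[x_1,\dots,x_n]$ by $\mathrm{wt}(x_i)=w_i$, and may be normalised so that $\gcd(w_1,\dots,w_n)=1$. It is parabolic if some $w_i=0$. A polynomial map $G=(G_1,\dots,G_n)\colon\mathbb{C}^n\to\mathbb{C}^n$ is graded $\mathbb{A}^n_{\mathbf w}\to\mathbb{A}^n_{\mathbf w}$ if each $G_j$ is weight-homogeneous of weight $w_j$, i.e. all its monomials have weight $w_j$. A Keller map is a polynomial map whose Jacobian determinant is a nonzero constant; a polynomial automorphism is a bijective polynomial map with polynomial inverse. $\mathcal{K}(n,\mathbf w)$ denotes the set of graded Keller maps $\mathbb{A}^n_{\mathbf w}\to\mathbb{A}^n_{\mathbf w}$ which are not polynomial automorphisms, up to composition with graded automorphisms of source and target. The Jacobian Conjecture in dimension $z$ is the assertion that every Keller map $\mathbb{C}^z\to\mathbb{C}^z$ is a polynomial automorphism. *)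

theory Defs
  imports "HOL-Library.Poly_Mapping" "Jordan_Normal_Form.Determinant"
begin

text \<open>A polynomial over the complex numbers is a finitely supported family of coefficients
  indexed by exponent vectors; the variables are \<open>x\<^sub>0, x\<^sub>1, \<dots>\<close>, and the polynomials in \<open>n\<close> variables
  are those involving only \<open>x\<^sub>0, \<dots>, x\<^bsub>n-1\<^esub>\<close>. Multiplication is the convolution product of
  \<^theory>\<open>HOL-Library.Poly_Mapping\<close>.\<close>

type_synonym monomial = "nat \<Rightarrow>\<^sub>0 nat"
type_synonym cpoly = "monomial \<Rightarrow>\<^sub>0 complex"

definition poly_vars :: "cpoly \<Rightarrow> nat set" where
  "poly_vars p = (\<Union>m \<in> Poly_Mapping.keys p. Poly_Mapping.keys m)"

definition poly_eval :: "complex vec \<Rightarrow> cpoly \<Rightarrow> complex" where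
  "poly_eval x p =
     (\<Sum>m \<in> Poly_Mapping.keys p.
        Poly_Mapping.lookup p m * (\<Prod>i \<in> Poly_Mapping.keys m. (x $ i) ^ Poly_Mapping.lookup m i))"

text \<open>The truncated subtraction below is harmless: if \<open>x\<^sub>i\<close> does not occur in \<open>m\<close>, the
  coefficient is \<open>0\<close>.\<close>

definition partial_deriv :: "nat \<Rightarrow> cpoly \<Rightarrow> cpoly" where
  "partial_deriv i p =
     (\<Sum>m \<in> Poly_Mapping.keys p.
        Poly_Mapping.single (m - Poly_Mapping.single i 1)
          (of_nat (Poly_Mapping.lookup m i) * Poly_Mapping.lookup p m))"

definition is_poly_map :: "nat \<Rightarrow> cpoly vec \<Rightarrow> bool" where
  "is_poly_map n G \<longleftrightarrow> G \<in> carrier_vec n \<and> (\<forall>j<n. poly_vars (G $ j) \<subseteq> {..<n})"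

definition map_eval :: "cpoly vec \<Rightarrow> complex vec \<Rightarrow> complex vec" where
  "map_eval G x = map_vec (poly_eval x) G"

definition jacobian :: "nat \<Rightarrow> cpoly vec \<Rightarrow> cpoly mat" where
  "jacobian n G = mat n n (\<lambda>(i, j). partial_deriv j (G $ i))"

definition is_keller_map :: "nat \<Rightarrow> cpoly vec \<Rightarrow> bool" where
  "is_keller_map n G \<longleftrightarrow>
     is_poly_map n G \<and> (\<exists>c. c \<noteq> 0 \<and> det (jacobian n G) = Poly_Mapping.single 0 c)"

definition is_poly_automorphism :: "nat \<Rightarrow> cpoly vec \<Rightarrow> bool" where
  "is_poly_automorphism n G \<longleftrightarrow>
     is_poly_map n G \<and>
     bij_betw (map_eval G) (carrier_vec n) (carrier_vec n) \<and>
     (\<exists>H. is_poly_map n H \<and>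
          (\<forall>y \<in> carrier_vec n. map_eval H y = inv_into (carrier_vec n) (map_eval G) y))"

definition jacobian_conjecture :: "nat \<Rightarrow> bool" where
  "jacobian_conjecture n \<longleftrightarrow> (\<forall>F. is_keller_map n F \<longrightarrow> is_poly_automorphism n F)"

definition parabolic :: "int vec \<Rightarrow> bool" where
  "parabolic w \<longleftrightarrow> (\<exists>i < dim_vec w. w $ i = 0)"

definition monomial_weight :: "int vec \<Rightarrow> monomial \<Rightarrow> int" where
  "monomial_weight w m = (\<Sum>i \<in> Poly_Mapping.keys m. w $ i * int (Poly_Mapping.lookup m i))"

definition weight_homogeneous :: "int vec \<Rightarrow> int \<Rightarrow> cpoly \<Rightarrow> bool" where
  "weight_homogeneous w d p \<longleftrightarrow> (\<forall>m \<in> Poly_Mapping.keys p. monomial_weight w m = d)"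

definition is_graded_map :: "nat \<Rightarrow> int vec \<Rightarrow> cpoly vec \<Rightarrow> bool" where
  "is_graded_map n w G \<longleftrightarrow>
     is_poly_map n G \<and> (\<forall>j<n. weight_homogeneous w (w $ j) (G $ j))"

definition is_graded_automorphism :: "nat \<Rightarrow> int vec \<Rightarrow> cpoly vec \<Rightarrow> bool" where
  "is_graded_automorphism n w G \<longleftrightarrow> is_graded_map n w G \<and> is_poly_automorphism n G"

definition graded_keller_maps :: "nat \<Rightarrow> int vec \<Rightarrow> cpoly vec set" where
  "graded_keller_maps n w =
     {G. is_graded_map n w G \<and> is_keller_map n G \<and> \<not> is_poly_automorphism n G}"

text \<open>Composition is expressed through the induced maps on \<open>\<complex>\<^sup>n\<close>, which determine the polynomials
  because \<open>\<complex>\<close> is infinite.\<close>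

definition graded_equiv :: "nat \<Rightarrow> int vec \<Rightarrow> cpoly vec rel" where
  "graded_equiv n w =
     {(G, G'). G \<in> graded_keller_maps n w \<and> G' \<in> graded_keller_maps n w \<and>
        (\<exists>A B. is_graded_automorphism n w A \<and> is_graded_automorphism n w B \<and>
           (\<forall>x \<in> carrier_vec n. map_eval G' x = map_eval B (map_eval G (map_eval A x))))}"

definition graded_keller_classes :: "nat \<Rightarrow> int vec \<Rightarrow> cpoly vec set set" where
  "graded_keller_classes n w = graded_keller_maps n w // graded_equiv n w"

end

theory Submission
  imports Defs
begin

text \<open>Let the weights be nonnegative (otherwise negate them all; this does not change which maps are
  graded), and split the coordinates into the \<open>z\<close> coordinates \<open>u\<close> of weight zero and the others.
  A monomial of weight \<open>d\<close> only involves variables of weight at most \<open>d\<close>. So a graded map \<open>G\<close> has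
  the form \<open>(u, x) \<mapsto> (F(u), M(u) x + P(u, x))\<close>, where \<open>F\<close> is the weight-zero part, \<open>M(u)\<close> only
  mixes coordinates of the same weight, and the component of \<open>P\<close> of weight \<open>d\<close> only involves
  variables of weight smaller than \<open>d\<close>.

  Suppose that \<open>G\<close> is a Keller map. Its Jacobian matrix is block triangular, so
  \<open>det JF\<close> divides a nonzero constant polynomial and is therefore constant
  (\<open>keller_weight_zero_part\<close>): \<open>F\<close> is a Keller map in dimension \<open>z\<close>. If the Jacobian
  Conjecture holds there, then \<open>F\<close> is an automorphism. Since \<open>det M(u)\<close> is constant too, \<open>M\<close> has
  an inverse with polynomial entries, and \<open>G(u, x) = (v, y)\<close> can be solved by
  \<open>u = F\<^sup>-\<^sup>1(v)\<close> and then \<open>x = M(u)\<^sup>-\<^sup>1 (y - P(u, x))\<close>, one weight after the other. The solution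
  is polynomial in \<open>(v, y)\<close>, so \<open>G\<close> is an automorphism
  (\<open>graded_automorphism_if_weight_zero_part\<close>).

  Conversely, for a Keller map \<open>F\<close> in dimension \<open>z\<close> that is not an automorphism, the map
  \<open>(u, x) \<mapsto> (F(u), x)\<close> is graded, Keller, and not an automorphism
  (\<open>graded_keller_stabilization\<close>). Finally, a Keller map in one variable is affine, so
  the Jacobian Conjecture holds in dimension one.\<close>

section \<open>Evaluation and variables of polynomials\<close>

lemma sum_of_monomials: "p = (\<Sum>m\<in>Poly_Mapping.keys p. Poly_Mapping.single m (Poly_Mapping.lookup p m))"
  by (rule poly_mapping_eqI)
     (auto simp: lookup_sum lookup_single when_def in_keys_iff sum.delta')

lemma mult_sum_of_monomials:
  "p * q = (\<Sum>a\<in>Poly_Mapping.keys p. \<Sum>b\<in>Poly_Mapping.keys q.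
     Poly_Mapping.single (a + b) (Poly_Mapping.lookup p a * Poly_Mapping.lookup q b))"
  by (subst sum_of_monomials[of p], subst sum_of_monomials[of q])
     (simp add: sum_product mult_single)

definition monomial_eval :: "complex vec \<Rightarrow> monomial \<Rightarrow> complex" where
  "monomial_eval x m = (\<Prod>i\<in>Poly_Mapping.keys m. (x $ i) ^ Poly_Mapping.lookup m i)"

lemma poly_eval_alt:
  "poly_eval x p = (\<Sum>m\<in>Poly_Mapping.keys p. Poly_Mapping.lookup p m * monomial_eval x m)"
  by (simp add: poly_eval_def monomial_eval_def)

lemma monomial_eval_superset:
  assumes "finite K" "Poly_Mapping.keys m \<subseteq> K"
  shows "monomial_eval x m = (\<Prod>i\<in>K. (x $ i) ^ Poly_Mapping.lookup m i)"
  unfolding monomial_eval_def using assms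
  by (intro prod.mono_neutral_left) (auto simp: in_keys_iff)

lemma keys_add_nat: "Poly_Mapping.keys (a + b :: monomial) = Poly_Mapping.keys a \<union> Poly_Mapping.keys b"
  by (auto simp: in_keys_iff lookup_add)

lemma monomial_eval_add: "monomial_eval x (a + b) = monomial_eval x a * monomial_eval x b"
proof -
  let ?K = "Poly_Mapping.keys a \<union> Poly_Mapping.keys b"
  have "monomial_eval x (a + b) = (\<Prod>i\<in>?K. (x $ i) ^ Poly_Mapping.lookup (a + b) i)"
    by (rule monomial_eval_superset) (auto simp: keys_add_nat)
  also have "\<dots> = (\<Prod>i\<in>?K. (x $ i) ^ Poly_Mapping.lookup a i) * (\<Prod>i\<in>?K. (x $ i) ^ Poly_Mapping.lookup b i)"
    by (simp add: lookup_add power_add prod.distrib)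
  also have "\<dots> = monomial_eval x a * monomial_eval x b"
    by (simp add: monomial_eval_superset[where K = ?K])
  finally show ?thesis .
qed

lemma monomial_eval_0 [simp]: "monomial_eval x 0 = 1"
  by (simp add: monomial_eval_def)

lemma monomial_eval_single [simp]: "monomial_eval x (Poly_Mapping.single i k) = x $ i ^ k"
  by (cases "k = 0") (auto simp: monomial_eval_def)

lemma poly_eval_0 [simp]: "poly_eval x 0 = 0"
  by (simp add: poly_eval_def)

lemma poly_eval_single [simp]: "poly_eval x (Poly_Mapping.single m c) = c * monomial_eval x m"
  by (cases "c = 0") (auto simp: poly_eval_alt)

lemma poly_eval_add: "poly_eval x (p + q) = poly_eval x p + poly_eval x q"
  unfolding poly_eval_alt
  by (rule setsum_keys_plus_distrib[where f = "\<lambda>m c. c * monomial_eval x m"])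
     (auto simp: algebra_simps)

lemma poly_eval_sum: "poly_eval x (\<Sum>i\<in>A. f i) = (\<Sum>i\<in>A. poly_eval x (f i))"
  by (induction A rule: infinite_finite_induct) (auto simp: poly_eval_add)

lemma poly_eval_mult: "poly_eval x (p * q) = poly_eval x p * poly_eval x q"
  unfolding mult_sum_of_monomials[of p q] poly_eval_sum poly_eval_single monomial_eval_add
  by (simp add: poly_eval_alt sum_product mult_ac)

lemma poly_eval_1 [simp]: "poly_eval x 1 = 1"
  by (simp add: poly_eval_alt)

lemma poly_vars_subset_iff:
  "poly_vars p \<subseteq> S \<longleftrightarrow> (\<forall>m\<in>Poly_Mapping.keys p. Poly_Mapping.keys m \<subseteq> S)"
  by (auto simp: poly_vars_def)

lemma poly_vars_single: "Poly_Mapping.keys m \<subseteq> S \<Longrightarrow> poly_vars (Poly_Mapping.single m c) \<subseteq> S"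
  by (auto simp: poly_vars_subset_iff)

lemma poly_vars_0 [simp]: "poly_vars 0 = {}" and poly_vars_1 [simp]: "poly_vars 1 = {}"
  by (auto simp: poly_vars_def)

lemma poly_vars_add: "poly_vars p \<subseteq> S \<Longrightarrow> poly_vars q \<subseteq> S \<Longrightarrow> poly_vars (p + q) \<subseteq> S"
  using keys_add[of p q] by (auto simp: poly_vars_subset_iff)

lemma poly_vars_uminus [simp]: "poly_vars (- p) = poly_vars p"
  by (simp add: poly_vars_def)

lemma poly_vars_mult: "poly_vars p \<subseteq> S \<Longrightarrow> poly_vars q \<subseteq> S \<Longrightarrow> poly_vars (p * q) \<subseteq> S"
  unfolding poly_vars_subset_iff
proof
  fix m
  assume p: "\<forall>m\<in>Poly_Mapping.keys p. Poly_Mapping.keys m \<subseteq> S"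
    and q: "\<forall>m\<in>Poly_Mapping.keys q. Poly_Mapping.keys m \<subseteq> S"
    and "m \<in> Poly_Mapping.keys (p * q)"
  then obtain a b where "m = a + b" "a \<in> Poly_Mapping.keys p" "b \<in> Poly_Mapping.keys q"
    using keys_mult[of p q] by auto
  then show "Poly_Mapping.keys m \<subseteq> S"
    using p q keys_add[of a b] by blast
qed

lemma poly_vars_sum: "(\<And>i. i \<in> A \<Longrightarrow> poly_vars (f i) \<subseteq> S) \<Longrightarrow> poly_vars (\<Sum>i\<in>A. f i) \<subseteq> S"
  by (induction A rule: infinite_finite_induct) (simp_all add: poly_vars_add)

lemma poly_vars_prod: "(\<And>i. i \<in> A \<Longrightarrow> poly_vars (f i) \<subseteq> S) \<Longrightarrow> poly_vars (\<Prod>i\<in>A. f i) \<subseteq> S"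
  by (induction A rule: infinite_finite_induct) (simp_all add: poly_vars_mult)

lemma poly_vars_signof_mult: "poly_vars p \<subseteq> S \<Longrightarrow> poly_vars (signof s * p) \<subseteq> S"
  using signof_pm_one[of s, where 'a = cpoly] by auto

lemma poly_vars_det:
  assumes "A \<in> carrier_mat n n" "\<And>i j. i < n \<Longrightarrow> j < n \<Longrightarrow> poly_vars (A $$ (i, j)) \<subseteq> S"
  shows "poly_vars (det A) \<subseteq> S"
  unfolding det_def'[OF assms(1)]
  by (intro poly_vars_sum poly_vars_signof_mult poly_vars_prod assms(2))
     (auto simp: permutes_in_image)

lemma poly_eval_cong:
  assumes "\<And>i. i \<in> poly_vars p \<Longrightarrow> x $ i = y $ i"
  shows "poly_eval x p = poly_eval y p"
proof -
  have "monomial_eval x m = monomial_eval y m" if "m \<in> Poly_Mapping.keys p" for m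
    unfolding monomial_eval_def
  proof (rule prod.cong)
    fix i assume "i \<in> Poly_Mapping.keys m"
    with that have "i \<in> poly_vars p" unfolding poly_vars_def by blast
    then show "x $ i ^ Poly_Mapping.lookup m i = y $ i ^ Poly_Mapping.lookup m i"
      by (simp add: assms)
  qed simp
  then show ?thesis unfolding poly_eval_alt by simp
qed

section \<open>Partial derivatives\<close>

lemma lookup_partial_deriv:
  "Poly_Mapping.lookup (partial_deriv i p) m =
     of_nat (Poly_Mapping.lookup m i + 1) * Poly_Mapping.lookup p (m + Poly_Mapping.single i 1)"
proof -
  let ?e = "Poly_Mapping.single i (1::nat)"
  have eq: "k - ?e = m \<longleftrightarrow> k = m + ?e" if "Poly_Mapping.lookup k i \<noteq> 0" for k
    using that by (auto simp: poly_mapping_eq_iff fun_eq_iff lookup_minus lookup_add lookup_single when_def)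
  have "Poly_Mapping.lookup (partial_deriv i p) m = (\<Sum>k\<in>Poly_Mapping.keys p.
      (of_nat (Poly_Mapping.lookup k i) * Poly_Mapping.lookup p k when k - ?e = m))"
    by (simp add: partial_deriv_def lookup_sum lookup_single)
  also have "\<dots> = (\<Sum>k\<in>Poly_Mapping.keys p. if k = m + ?e then
      of_nat (Poly_Mapping.lookup k i) * Poly_Mapping.lookup p k else 0)"
    by (rule sum.cong) (use eq in \<open>auto simp: when_def lookup_add\<close>)
  also have "\<dots> = of_nat (Poly_Mapping.lookup m i + 1) * Poly_Mapping.lookup p (m + ?e)"
    by (auto simp: in_keys_iff lookup_add)
  finally show ?thesis .
qed

lemma keys_partial_deriv:
  "m \<in> Poly_Mapping.keys (partial_deriv i p) \<longleftrightarrow> m + Poly_Mapping.single i 1 \<in> Poly_Mapping.keys p"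
  by (simp add: in_keys_iff lookup_partial_deriv del: of_nat_Suc)

lemma poly_vars_partial_deriv:
  assumes "poly_vars p \<subseteq> S"
  shows "poly_vars (partial_deriv i p) \<subseteq> S"
  unfolding poly_vars_subset_iff
proof
  fix m assume "m \<in> Poly_Mapping.keys (partial_deriv i p)"
  then have "m + Poly_Mapping.single i 1 \<in> Poly_Mapping.keys p"
    unfolding keys_partial_deriv .
  with assms have "Poly_Mapping.keys (m + Poly_Mapping.single i 1) \<subseteq> S"
    unfolding poly_vars_subset_iff by (rule bspec)
  then show "Poly_Mapping.keys m \<subseteq> S"
    unfolding keys_add_nat by simp
qed

lemma partial_deriv_eq_0:
  assumes "i \<notin> poly_vars p"
  shows "partial_deriv i p = 0"
proof (rule poly_mapping_eqI)
  fix m :: monomial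
  have "i \<in> Poly_Mapping.keys (m + Poly_Mapping.single i 1)"
    unfolding keys_add_nat by simp
  then have "m + Poly_Mapping.single i 1 \<notin> Poly_Mapping.keys p"
    using assms unfolding poly_vars_def by (metis UN_I)
  then show "Poly_Mapping.lookup (partial_deriv i p) m = Poly_Mapping.lookup 0 m"
    by (simp add: lookup_partial_deriv in_keys_iff)
qed

lemma partial_deriv_variable:
  "partial_deriv j (Poly_Mapping.single (Poly_Mapping.single i 1) 1) = (if i = j then 1 else 0)"
  by (rule poly_mapping_eqI)
     (auto simp: lookup_partial_deriv lookup_single lookup_one when_def poly_mapping_eq_iff fun_eq_iff lookup_add split: if_splits)

text \<open>The operator \<open>x\<^sub>i \<partial>\<^sub>i\<close> multiplies every monomial by its exponent at \<open>x\<^sub>i\<close>. Summed over the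
  variables of one weight, this is how the part \<open>M(u) x\<close> of a graded map is recognised inside it.\<close>

lemma poly_eval_euler:
  "poly_eval x (partial_deriv i p) * x $ i =
     (\<Sum>m\<in>Poly_Mapping.keys p. of_nat (Poly_Mapping.lookup m i) * Poly_Mapping.lookup p m * monomial_eval x m)"
proof -
  let ?e = "Poly_Mapping.single i (1::nat)"
  have *: "monomial_eval x (m - ?e) * x $ i = monomial_eval x m" if "Poly_Mapping.lookup m i \<noteq> 0" for m
  proof -
    have "m = m - ?e + ?e"
      using that by (auto simp: poly_mapping_eq_iff fun_eq_iff lookup_minus lookup_add lookup_single when_def)
    then have "monomial_eval x m = monomial_eval x (m - ?e) * monomial_eval x ?e"
      by (metis monomial_eval_add)
    then show ?thesis by simp
  qed
  show ?thesis
    unfolding partial_deriv_def poly_eval_sum sum_distrib_right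
    by (rule sum.cong) (use * in \<open>auto simp: mult.assoc\<close>)
qed

section \<open>Factors of constants\<close>

text \<open>The linear order on exponent vectors is lexicographic: a nonzero vector is positive because
  its first nonzero entry is.\<close>

lemma zero_le_monomial: "0 \<le> (a :: monomial)"
proof (cases "a = 0")
  case False
  define P where "P = (\<lambda>k. Poly_Mapping.lookup a k \<noteq> 0)"
  have ex: "\<exists>k. P k"
  proof (rule ccontr)
    assume "\<nexists>k. P k"
    then have "a = 0" by (intro poly_mapping_eqI) (simp add: P_def)
    with False show False ..
  qed
  define l where "l = Least P"
  have l: "P l" unfolding l_def using ex by (rule LeastI_ex)
  have below: "\<not> P k" if "k < l" for k
    using that unfolding l_def by (rule not_less_Least)
  have "less_fun (Poly_Mapping.lookup 0) (Poly_Mapping.lookup a)"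
    unfolding less_fun_def
  proof (rule exI[of _ l], intro conjI allI impI)
    show "Poly_Mapping.lookup 0 l < Poly_Mapping.lookup a l" using l by (simp add: P_def)
    show "Poly_Mapping.lookup 0 k = Poly_Mapping.lookup a k" if "k < l" for k
      using below[OF that] by (simp add: P_def)
  qed
  then show ?thesis unfolding less_eq_poly_mapping.rep_eq by (rule disjI1)
qed simp

text \<open>Leading monomials add up under multiplication, so those of both factors of a constant have
  exponent zero, and the zero exponent vector is the smallest one.\<close>

lemma factor_of_constant_is_constant:
  fixes p q :: cpoly
  assumes pq: "p * q = Poly_Mapping.single 0 c" and "c \<noteq> 0"
  shows "\<exists>d. d \<noteq> 0 \<and> p = Poly_Mapping.single 0 d"
proof -
  have nz: "p \<noteq> 0" "q \<noteq> 0" using assms by (auto dest: arg_cong[where f = "\<lambda>r. Poly_Mapping.lookup r 0"])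
  let ?P = "Poly_Mapping.keys p" and ?Q = "Poly_Mapping.keys q"
  have max: "Max ?P \<in> ?P" "Max ?Q \<in> ?Q" "\<And>a. a \<in> ?P \<Longrightarrow> a \<le> Max ?P" "\<And>b. b \<in> ?Q \<Longrightarrow> b \<le> Max ?Q"
    using nz by auto
  have uniq: "a + b = Max ?P + Max ?Q \<longleftrightarrow> a = Max ?P \<and> b = Max ?Q" if "a \<in> ?P" "b \<in> ?Q" for a b
  proof (cases "a = Max ?P")
    case False
    then have "a + b < Max ?P + Max ?Q"
      using max(3)[OF that(1)] max(4)[OF that(2)] by (intro add_less_le_mono) simp_all
    with False show ?thesis by simp
  qed simp
  have "Poly_Mapping.lookup (p * q) (Max ?P + Max ?Q) = (\<Sum>a\<in>?P. \<Sum>b\<in>?Q.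
      if b = Max ?Q then if a = Max ?P then Poly_Mapping.lookup p a * Poly_Mapping.lookup q b else 0 else 0)"
    unfolding mult_sum_of_monomials[of p q] lookup_sum by (intro sum.cong refl) (auto simp: lookup_single when_def uniq)
  also have "\<dots> = Poly_Mapping.lookup p (Max ?P) * Poly_Mapping.lookup q (Max ?Q)"
    using max(1,2) by (simp add: sum.delta)
  finally have "Poly_Mapping.lookup (p * q) (Max ?P + Max ?Q) \<noteq> 0"
    using max(1,2) by (auto simp: in_keys_iff)
  then have "Max ?P + Max ?Q = 0"
    unfolding pq by (auto simp: lookup_single when_def split: if_splits)
  then have "Poly_Mapping.lookup (Max ?P + Max ?Q) i = 0" for i by simp
  then have 0: "Max ?P = 0" by (intro poly_mapping_eqI) (simp add: lookup_add)
  have "a = 0" if "a \<in> ?P" for a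
  proof -
    have "0 \<le> a" by (rule zero_le_monomial)
    with max(3)[OF that] 0 show ?thesis by simp
  qed
  moreover have "0 \<in> ?P" using max(1) unfolding 0 .
  ultimately have "?P = {0}" by (intro equalityI subsetI) auto
  then have sum_eq: "(\<Sum>m\<in>?P. Poly_Mapping.single m (Poly_Mapping.lookup p m)) =
      Poly_Mapping.single 0 (Poly_Mapping.lookup p 0)"
    by simp
  have p: "p = Poly_Mapping.single 0 (Poly_Mapping.lookup p 0)"
    by (rule trans[OF sum_of_monomials sum_eq])
  have "Poly_Mapping.lookup p 0 \<noteq> 0"
    using \<open>0 \<in> ?P\<close> unfolding in_keys_iff .
  with p show ?thesis by (intro exI[of _ "Poly_Mapping.lookup p 0"] conjI)
qed

section \<open>Renaming variables\<close>

text \<open>For a bijection \<open>\<sigma>\<close> this substitutes \<open>x\<^bsub>\<sigma> i\<^esub>\<close> for \<open>x\<^sub>i\<close>: the coefficient at the exponent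
  vector \<open>m\<close> of the result is that of the original polynomial at \<open>m \<circ> \<sigma>\<close>. It transports polynomials
  between the weight-zero variables and \<open>x\<^sub>0, \<dots>, x\<^bsub>z-1\<^esub>\<close>.\<close>

definition rename_vars :: "(nat \<Rightarrow> nat) \<Rightarrow> cpoly \<Rightarrow> cpoly" where
  "rename_vars \<sigma> p = Poly_Mapping.map_key (Poly_Mapping.map_key \<sigma>) p"

lemma lookup_map_key: "inj f \<Longrightarrow> Poly_Mapping.lookup (Poly_Mapping.map_key f p) k = Poly_Mapping.lookup p (f k)"
  by (simp add: map_key.rep_eq)

context
  fixes \<sigma> :: "nat \<Rightarrow> nat"
  assumes bij: "bij \<sigma>"
begin

lemma inj_renaming: "inj \<sigma>"
  using bij by (rule bij_is_inj)

lemma map_key_cancel: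
  "Poly_Mapping.map_key \<sigma> (Poly_Mapping.map_key (inv_into UNIV \<sigma>) m) = (m :: monomial)"
  "Poly_Mapping.map_key (inv_into UNIV \<sigma>) (Poly_Mapping.map_key \<sigma> m) = (m :: monomial)"
  using bij bij_imp_bij_inv[OF bij]
  by (auto intro!: poly_mapping_eqI simp: lookup_map_key bij_is_inj bij_is_surj surj_f_inv_f)

lemma bij_map_key: "bij (Poly_Mapping.map_key \<sigma> :: monomial \<Rightarrow> monomial)"
  by (rule o_bij[of "Poly_Mapping.map_key (inv_into UNIV \<sigma>)"]) (auto simp: fun_eq_iff map_key_cancel)

lemma lookup_rename_vars:
  "Poly_Mapping.lookup (rename_vars \<sigma> p) m = Poly_Mapping.lookup p (Poly_Mapping.map_key \<sigma> m)"
  unfolding rename_vars_def by (rule lookup_map_key[OF bij_is_inj[OF bij_map_key]])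

lemma rename_vars_const [simp]: "rename_vars \<sigma> (Poly_Mapping.single 0 c) = Poly_Mapping.single 0 c"
  unfolding rename_vars_def
  using map_key_single[OF bij_is_inj[OF bij_map_key], of 0 c] unfolding map_key_zero[OF inj_renaming] .

lemma rename_vars_add: "rename_vars \<sigma> (p + q) = rename_vars \<sigma> p + rename_vars \<sigma> q"
  unfolding rename_vars_def by (rule map_key_plus[OF bij_is_inj[OF bij_map_key]])

lemma rename_vars_mult: "rename_vars \<sigma> (p * q) = rename_vars \<sigma> p * rename_vars \<sigma> q"
proof (rule poly_mapping_eqI)
  fix m
  let ?r = "Poly_Mapping.map_key \<sigma> :: monomial \<Rightarrow> monomial"
  let ?p = "Poly_Mapping.lookup p" and ?q = "Poly_Mapping.lookup q"
  have inner: "(\<Sum>k. ?q k when ?r m = ?r l + k) = (\<Sum>k. ?q (?r k) when m = l + k)" for l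
  proof (rule Sum_any.reindex_cong[OF bij_map_key])
    have "?r m = ?r l + ?r k \<longleftrightarrow> m = l + k" for k
      unfolding map_key_plus[OF inj_renaming, symmetric]
      by (rule inj_eq[OF bij_is_inj[OF bij_map_key]])
    then show "(\<lambda>k. ?q k when ?r m = ?r l + k) \<circ> ?r = (\<lambda>k. ?q (?r k) when m = l + k)"
      by (simp add: fun_eq_iff)
  qed
  have "Poly_Mapping.lookup (rename_vars \<sigma> (p * q)) m = (\<Sum>l. ?p l * (\<Sum>k. ?q k when ?r m = l + k))"
    by (simp add: lookup_rename_vars lookup_mult)
  also have "\<dots> = (\<Sum>l. ?p (?r l) * (\<Sum>k. ?q (?r k) when m = l + k))"
    by (rule Sum_any.reindex_cong[OF bij_map_key]) (simp add: fun_eq_iff inner)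
  also have "\<dots> = Poly_Mapping.lookup (rename_vars \<sigma> p * rename_vars \<sigma> q) m"
    by (simp add: lookup_rename_vars lookup_mult)
  finally show "Poly_Mapping.lookup (rename_vars \<sigma> (p * q)) m = \<dots>" .
qed

lemma rename_vars_hom: "comm_ring_hom (rename_vars \<sigma>)"
  using rename_vars_const[of 0] rename_vars_const[of 1]
  by unfold_locales (simp_all add: rename_vars_add rename_vars_mult)

lemma partial_deriv_rename_vars:
  "partial_deriv (\<sigma> i) (rename_vars \<sigma> p) = rename_vars \<sigma> (partial_deriv i p)"
proof (rule poly_mapping_eqI)
  fix m :: monomial
  have "Poly_Mapping.map_key \<sigma> (m + Poly_Mapping.single (\<sigma> i) 1) =
      Poly_Mapping.map_key \<sigma> m + Poly_Mapping.single i 1"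
    by (simp only: map_key_plus[OF inj_renaming] map_key_single[OF inj_renaming])
  then show "Poly_Mapping.lookup (partial_deriv (\<sigma> i) (rename_vars \<sigma> p)) m =
      Poly_Mapping.lookup (rename_vars \<sigma> (partial_deriv i p)) m"
    by (simp add: lookup_rename_vars lookup_partial_deriv lookup_map_key[OF inj_renaming])
qed

lemma keys_rename_vars:
  "m \<in> Poly_Mapping.keys (rename_vars \<sigma> p) \<longleftrightarrow> Poly_Mapping.map_key \<sigma> m \<in> Poly_Mapping.keys p"
  by (simp add: in_keys_iff lookup_rename_vars)

lemma keys_map_key_image: "Poly_Mapping.keys m = \<sigma> ` Poly_Mapping.keys (Poly_Mapping.map_key \<sigma> m)"
  using bij by (simp add: keys_map_key[OF inj_renaming] bij_is_surj surj_image_vimage_eq)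

lemma poly_vars_rename_vars: "poly_vars p \<subseteq> S \<Longrightarrow> poly_vars (rename_vars \<sigma> p) \<subseteq> \<sigma> ` S"
  unfolding poly_vars_subset_iff
proof
  fix m
  assume p: "\<forall>m\<in>Poly_Mapping.keys p. Poly_Mapping.keys m \<subseteq> S"
    and "m \<in> Poly_Mapping.keys (rename_vars \<sigma> p)"
  then have "Poly_Mapping.map_key \<sigma> m \<in> Poly_Mapping.keys p"
    unfolding keys_rename_vars by simp
  with p have "Poly_Mapping.keys (Poly_Mapping.map_key \<sigma> m) \<subseteq> S" by (rule bspec)
  then show "Poly_Mapping.keys m \<subseteq> \<sigma> ` S"
    unfolding keys_map_key_image[of m] by (rule image_mono)
qed

lemma poly_eval_rename_vars:
  assumes "\<And>i. i \<in> poly_vars p \<Longrightarrow> y $ i = x $ \<sigma> i"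
  shows "poly_eval x (rename_vars \<sigma> p) = poly_eval y p"
proof -
  let ?r = "Poly_Mapping.map_key \<sigma> :: monomial \<Rightarrow> monomial"
  have me: "monomial_eval x m = monomial_eval y (?r m)" if "?r m \<in> Poly_Mapping.keys p" for m
  proof -
    have "monomial_eval x m = (\<Prod>i\<in>Poly_Mapping.keys (?r m). (x $ \<sigma> i) ^ Poly_Mapping.lookup m (\<sigma> i))"
      unfolding monomial_eval_def keys_map_key_image[of m]
      by (subst prod.reindex) (auto intro: inj_on_subset[OF inj_renaming])
    also have "\<dots> = monomial_eval y (?r m)"
      unfolding monomial_eval_def
    proof (rule prod.cong)
      fix i assume "i \<in> Poly_Mapping.keys (?r m)"
      with that have "i \<in> poly_vars p" unfolding poly_vars_def by blast
      then show "(x $ \<sigma> i) ^ Poly_Mapping.lookup m (\<sigma> i) = (y $ i) ^ Poly_Mapping.lookup (?r m) i"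
        by (simp add: assms lookup_map_key[OF inj_renaming])
    qed simp
    finally show ?thesis .
  qed
  have im: "Poly_Mapping.keys p = ?r ` Poly_Mapping.keys (rename_vars \<sigma> p)"
    unfolding rename_vars_def keys_map_key[OF bij_is_inj[OF bij_map_key]]
    by (rule surj_image_vimage_eq[OF bij_is_surj[OF bij_map_key], symmetric])
  have inj: "inj_on ?r (Poly_Mapping.keys (rename_vars \<sigma> p))"
    by (rule inj_on_subset[OF bij_is_inj[OF bij_map_key]]) simp
  have "poly_eval y p = (\<Sum>m\<in>Poly_Mapping.keys (rename_vars \<sigma> p).
      Poly_Mapping.lookup p (?r m) * monomial_eval y (?r m))"
    unfolding poly_eval_alt im by (subst sum.reindex[OF inj]) simp
  also have "\<dots> = poly_eval x (rename_vars \<sigma> p)"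
    unfolding poly_eval_alt
    by (rule sum.cong) (simp_all add: lookup_rename_vars me keys_rename_vars)
  finally show ?thesis by simp
qed

end

section \<open>Determinants of block matrices\<close>

lemma det_conjugate_permutation:
  fixes C :: "'a :: comm_ring_1 mat"
  assumes C: "C \<in> carrier_mat n n" and p: "p permutes {0..<n}"
  shows "det (mat n n (\<lambda>(i, j). C $$ (p i, p j))) = det C"
proof -
  have pn: "p i < n" if "i < n" for i using permutes_in_image[OF p, of i] that by simp
  define B where "B = mat n n (\<lambda>(i, j). C $$ (i, p j))"
  have "transpose_mat B = mat n n (\<lambda>(i, j). transpose_mat C $$ (p i, j))"
    unfolding B_def using C pn by (intro eq_matI) auto
  then have "det B = signof p * det C"
    using det_permute_rows[OF _ p, of "transpose_mat C"] C det_transpose[OF C]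
      det_transpose[of B n] by (simp add: B_def)
  moreover have "mat n n (\<lambda>(i, j). C $$ (p i, p j)) = mat n n (\<lambda>(i, j). B $$ (p i, j))"
    unfolding B_def using pn by (intro eq_matI) auto
  then have "det (mat n n (\<lambda>(i, j). C $$ (p i, p j))) = signof p * det B"
    using det_permute_rows[OF _ p, of B] by (simp add: B_def)
  moreover have "signof p * signof p = (1 :: 'a)"
    using signof_pm_one[of p, where 'a = 'a] by auto
  ultimately show ?thesis by (simp flip: mult.assoc)
qed

lemma det_block_triangular:
  fixes C :: "'a :: idom mat"
  assumes C: "C \<in> carrier_mat n n" and p: "p permutes {0..<n}" and z: "z \<le> n"
    and zero: "\<And>i j. i < z \<Longrightarrow> z \<le> j \<Longrightarrow> j < n \<Longrightarrow> C $$ (p i, p j) = 0"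
  shows "det C = det (mat z z (\<lambda>(i, j). C $$ (p i, p j))) *
    det (mat (n - z) (n - z) (\<lambda>(i, j). C $$ (p (z + i), p (z + j))))" (is "_ = det ?A * det ?B")
proof -
  have "mat n n (\<lambda>(i, j). C $$ (p i, p j)) =
      four_block_mat ?A (0\<^sub>m z (n - z)) (mat (n - z) z (\<lambda>(i, j). C $$ (p (z + i), p j))) ?B"
    using z by (intro eq_matI) (auto simp: zero)
  then show ?thesis
    unfolding det_conjugate_permutation[OF C p, symmetric]
    by (simp add: det_four_block_mat_upper_right_zero[of _ z _ "n - z"])
qed

section \<open>Polynomial functions and automorphisms\<close>

text \<open>Inverse maps are constructed as functions by iteration; the closure properties below show
  that they are given by polynomials without ever writing these down.\<close>

definition polynomial_function :: "nat \<Rightarrow> (complex vec \<Rightarrow> complex) \<Rightarrow> bool" where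
  "polynomial_function n f \<longleftrightarrow>
     (\<exists>p. poly_vars p \<subseteq> {..<n} \<and> (\<forall>x\<in>carrier_vec n. f x = poly_eval x p))"

lemma polynomial_function_poly: "poly_vars p \<subseteq> {..<n} \<Longrightarrow> polynomial_function n (\<lambda>x. poly_eval x p)"
  unfolding polynomial_function_def by blast

lemma polynomial_function_const: "polynomial_function n (\<lambda>x. c)"
  using polynomial_function_poly[of "Poly_Mapping.single 0 c" n] by (simp add: poly_vars_def)

lemma polynomial_function_coord: "i < n \<Longrightarrow> polynomial_function n (\<lambda>x. x $ i)"
  using polynomial_function_poly[of "Poly_Mapping.single (Poly_Mapping.single i 1) 1" n]
  by (simp add: poly_vars_def)

lemma polynomial_function_add:
  assumes "polynomial_function n f" "polynomial_function n g"
  shows "polynomial_function n (\<lambda>x. f x + g x)"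
proof -
  obtain p q where "poly_vars p \<subseteq> {..<n}" "\<forall>x\<in>carrier_vec n. f x = poly_eval x p"
    "poly_vars q \<subseteq> {..<n}" "\<forall>x\<in>carrier_vec n. g x = poly_eval x q"
    using assms unfolding polynomial_function_def by auto
  then show ?thesis unfolding polynomial_function_def
    by (intro exI[of _ "p + q"]) (simp add: poly_vars_add poly_eval_add)
qed

lemma polynomial_function_mult:
  assumes "polynomial_function n f" "polynomial_function n g"
  shows "polynomial_function n (\<lambda>x. f x * g x)"
proof -
  obtain p q where "poly_vars p \<subseteq> {..<n}" "\<forall>x\<in>carrier_vec n. f x = poly_eval x p"
    "poly_vars q \<subseteq> {..<n}" "\<forall>x\<in>carrier_vec n. g x = poly_eval x q"
    using assms unfolding polynomial_function_def by auto
  then show ?thesis unfolding polynomial_function_def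
    by (intro exI[of _ "p * q"]) (simp add: poly_vars_mult poly_eval_mult)
qed

lemma polynomial_function_diff:
  assumes "polynomial_function n f" "polynomial_function n g"
  shows "polynomial_function n (\<lambda>x. f x - g x)"
  using polynomial_function_add[OF assms(1) polynomial_function_mult[OF polynomial_function_const[of n "-1"] assms(2)]]
  by simp

lemma polynomial_function_power: "polynomial_function n f \<Longrightarrow> polynomial_function n (\<lambda>x. f x ^ k)"
  by (induction k) (simp_all add: polynomial_function_const polynomial_function_mult)

lemma polynomial_function_sum:
  "(\<And>i. i \<in> A \<Longrightarrow> polynomial_function n (f i)) \<Longrightarrow> polynomial_function n (\<lambda>x. \<Sum>i\<in>A. f i x)"
  by (induction A rule: infinite_finite_induct)
     (simp_all add: polynomial_function_const polynomial_function_add)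

lemma polynomial_function_prod:
  "(\<And>i. i \<in> A \<Longrightarrow> polynomial_function n (f i)) \<Longrightarrow> polynomial_function n (\<lambda>x. \<Prod>i\<in>A. f i x)"
  by (induction A rule: infinite_finite_induct)
     (simp_all add: polynomial_function_const polynomial_function_mult)

lemma polynomial_function_compose:
  assumes "\<And>i. i \<in> poly_vars p \<Longrightarrow> polynomial_function n (\<lambda>x. g x $ i)"
  shows "polynomial_function n (\<lambda>x. poly_eval (g x) p)"
  unfolding poly_eval_def
proof (intro polynomial_function_sum polynomial_function_mult polynomial_function_const
    polynomial_function_prod polynomial_function_power)
  fix m i assume "m \<in> Poly_Mapping.keys p" "i \<in> Poly_Mapping.keys m"
  then have "i \<in> poly_vars p" unfolding poly_vars_def by blast
  then show "polynomial_function n (\<lambda>x. g x $ i)" by (rule assms)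
qed

lemma map_eval_carrier: "is_poly_map n G \<Longrightarrow> map_eval G x \<in> carrier_vec n"
  by (simp add: is_poly_map_def map_eval_def)

lemma map_eval_index: "is_poly_map n G \<Longrightarrow> j < n \<Longrightarrow> map_eval G x $ j = poly_eval x (G $ j)"
  by (auto simp: is_poly_map_def map_eval_def)

lemma poly_automorphismI:
  assumes G: "is_poly_map n G"
    and h: "\<And>j. j < n \<Longrightarrow> polynomial_function n (h j)"
    and left: "\<And>x. x \<in> carrier_vec n \<Longrightarrow> vec n (\<lambda>j. h j (map_eval G x)) = x"
    and right: "\<And>y. y \<in> carrier_vec n \<Longrightarrow> map_eval G (vec n (\<lambda>j. h j y)) = y"
  shows "is_poly_automorphism n G"
  unfolding is_poly_automorphism_def
proof (intro conjI G)
  show bij: "bij_betw (map_eval G) (carrier_vec n) (carrier_vec n)"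
    by (rule bij_betwI[where g = "\<lambda>y. vec n (\<lambda>j. h j y)"]) (auto simp: map_eval_carrier[OF G] left right)
  have "\<forall>j. \<exists>p. j < n \<longrightarrow> poly_vars p \<subseteq> {..<n} \<and> (\<forall>x\<in>carrier_vec n. h j x = poly_eval x p)"
    using h unfolding polynomial_function_def by blast
  then obtain P where P: "\<And>j. j < n \<Longrightarrow> poly_vars (P j) \<subseteq> {..<n}"
    "\<And>j x. j < n \<Longrightarrow> x \<in> carrier_vec n \<Longrightarrow> h j x = poly_eval x (P j)" by metis
  have H: "is_poly_map n (vec n P)" using P(1) by (simp add: is_poly_map_def)
  have "map_eval (vec n P) y = inv_into (carrier_vec n) (map_eval G) y" if y: "y \<in> carrier_vec n" for y
  proof -
    have "map_eval (vec n P) y = vec n (\<lambda>j. h j y)"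
      using P(2) y by (intro eq_vecI) (auto simp: map_eval_def)
    also have "\<dots> = inv_into (carrier_vec n) (map_eval G) y"
      using bij_betw_imp_inj_on[OF bij] right[OF y] by (intro inv_into_f_eq[symmetric]) auto
    finally show ?thesis .
  qed
  with H show "\<exists>H. is_poly_map n H \<and>
      (\<forall>y\<in>carrier_vec n. map_eval H y = inv_into (carrier_vec n) (map_eval G) y)" by blast
qed

lemma poly_automorphismE:
  assumes "is_poly_automorphism n G"
  obtains H where "is_poly_map n H"
    "\<And>x. x \<in> carrier_vec n \<Longrightarrow> map_eval H (map_eval G x) = x"
    "\<And>y. y \<in> carrier_vec n \<Longrightarrow> map_eval G (map_eval H y) = y"
proof -
  obtain H where bij: "bij_betw (map_eval G) (carrier_vec n) (carrier_vec n)"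
    and H: "is_poly_map n H" "\<And>y. y \<in> carrier_vec n \<Longrightarrow> map_eval H y = inv_into (carrier_vec n) (map_eval G) y"
    using assms unfolding is_poly_automorphism_def by blast
  show ?thesis
    by (rule that[of H])
       (use H bij in \<open>auto simp: bij_betw_inv_into_left bij_betw_inv_into_right bij_betwE\<close>)
qed

text \<open>Such a permutation moves the weight-zero indices to the front.\<close>

lemma exists_permutation_onto:
  assumes "Z \<subseteq> {..<n}" "card Z = z"
  obtains p where "p permutes {0..<n}" "\<And>i. i < n \<Longrightarrow> p i \<in> Z \<longleftrightarrow> i < z"
proof -
  have fin: "finite Z" using assms(1) finite_subset by blast
  have zn: "z \<le> n" using card_mono[OF _ assms(1)] assms(2) by simp
  obtain f where f: "bij_betw f {..<z} Z"
    using finite_same_card_bij[of "{..<z}" Z] fin assms(2) by auto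
  have "card ({..<n} - Z) = card {z..<n}" using assms fin by (simp add: card_Diff_subset)
  then obtain g where g: "bij_betw g {z..<n} ({..<n} - Z)"
    using finite_same_card_bij[of "{z..<n}" "{..<n} - Z"] by auto
  define p where "p i = (if i < z then f i else if i < n then g i else i)" for i
  have pf: "bij_betw p {..<z} Z" using f by (subst bij_betw_cong[of _ _ f]) (auto simp: p_def)
  have pg: "bij_betw p {z..<n} ({..<n} - Z)" using g by (subst bij_betw_cong[of _ _ g]) (auto simp: p_def)
  have "bij_betw p ({..<z} \<union> {z..<n}) (Z \<union> ({..<n} - Z))" by (rule bij_betw_combine[OF pf pg]) auto
  moreover have "{..<z} \<union> {z..<n} = {0..<n}" "Z \<union> ({..<n} - Z) = {0..<n}" using zn assms(1) by auto
  ultimately have "p permutes {0..<n}" using zn by (intro bij_imp_permutes) (auto simp: p_def)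
  moreover have "p i \<in> Z \<longleftrightarrow> i < z" if "i < n" for i
    using bij_betwE[OF pf] bij_betwE[OF pg] that by (cases "i < z") auto
  ultimately show ?thesis using that by blast
qed

section \<open>Weights\<close>

lemma monomial_weight_superset:
  assumes "finite K" "Poly_Mapping.keys m \<subseteq> K"
  shows "monomial_weight w m = (\<Sum>i\<in>K. w $ i * int (Poly_Mapping.lookup m i))"
  unfolding monomial_weight_def using assms
  by (intro sum.mono_neutral_left) (auto simp: in_keys_iff)

lemma monomial_weight_single [simp]: "monomial_weight w (Poly_Mapping.single i k) = w $ i * int k"
  by (subst monomial_weight_superset[of "{i}"]) (simp_all add: lookup_single)

lemma monomial_weight_add: "monomial_weight w (a + b) = monomial_weight w a + monomial_weight w b"
proof -
  let ?K = "Poly_Mapping.keys a \<union> Poly_Mapping.keys b"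
  have "monomial_weight w (a + b) = (\<Sum>i\<in>?K. w $ i * int (Poly_Mapping.lookup (a + b) i))"
    by (rule monomial_weight_superset) (simp_all add: keys_add_nat)
  also have "\<dots> = (\<Sum>i\<in>?K. w $ i * int (Poly_Mapping.lookup a i)) + (\<Sum>i\<in>?K. w $ i * int (Poly_Mapping.lookup b i))"
    by (simp add: lookup_add algebra_simps sum.distrib)
  also have "\<dots> = monomial_weight w a + monomial_weight w b"
    by (simp add: monomial_weight_superset[where K = ?K])
  finally show ?thesis .
qed

lemma weight_homogeneous_partial_deriv:
  assumes "weight_homogeneous w d p"
  shows "weight_homogeneous w (d - w $ i) (partial_deriv i p)"
  unfolding weight_homogeneous_def
proof
  fix m assume "m \<in> Poly_Mapping.keys (partial_deriv i p)"
  then have "m + Poly_Mapping.single i 1 \<in> Poly_Mapping.keys p" unfolding keys_partial_deriv .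
  with assms have "monomial_weight w (m + Poly_Mapping.single i 1) = d"
    unfolding weight_homogeneous_def by (rule bspec)
  then show "monomial_weight w m = d - w $ i" by (simp add: monomial_weight_add)
qed

lemma weight_part_le:
  assumes "\<forall>i<n. 0 \<le> w $ i" "Poly_Mapping.keys m \<subseteq> {..<n}" "L \<subseteq> {..<n}"
  shows "(\<Sum>i\<in>L. w $ i * int (Poly_Mapping.lookup m i)) \<le> monomial_weight w m"
  unfolding monomial_weight_superset[OF finite_lessThan assms(2)]
  by (rule sum_mono2) (use assms in auto)

lemma weight_var_le:
  assumes "\<forall>i<n. 0 \<le> w $ i" "Poly_Mapping.keys m \<subseteq> {..<n}" "i \<in> Poly_Mapping.keys m"
  shows "w $ i \<le> monomial_weight w m"
proof -
  have i: "i < n" using assms(2,3) by blast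
  have "1 \<le> Poly_Mapping.lookup m i" using assms(3) by (simp add: in_keys_iff)
  with i have "w $ i * 1 \<le> w $ i * int (Poly_Mapping.lookup m i)"
    using assms(1) by (intro mult_left_mono) auto
  also have "\<dots> \<le> monomial_weight w m"
    using weight_part_le[OF assms(1,2), of "{i}"] i by simp
  finally show ?thesis by simp
qed

lemma weight_homogeneous_var_le:
  assumes "\<forall>i<n. 0 \<le> w $ i" "poly_vars p \<subseteq> {..<n}" "weight_homogeneous w d p" "i \<in> poly_vars p"
  shows "w $ i \<le> d"
proof -
  obtain m where m: "m \<in> Poly_Mapping.keys p" "i \<in> Poly_Mapping.keys m"
    using assms(4) unfolding poly_vars_def by blast
  have "Poly_Mapping.keys m \<subseteq> {..<n}" using assms(2) m(1) unfolding poly_vars_subset_iff by (rule bspec)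
  then have "w $ i \<le> monomial_weight w m" using m(2) by (rule weight_var_le[OF assms(1)])
  also have "\<dots> = d" using assms(3) m(1) unfolding weight_homogeneous_def by (rule bspec)
  finally show ?thesis .
qed

text \<open>In the Leibniz formula, a permutation that changes the weight of some index must raise the
  weight of some index, because the total weight is preserved; its term then contains a zero entry.
  Hence only the blocks of equal weight contribute to the determinant.\<close>

lemma det_weight_diagonal:
  fixes A :: "'a :: comm_ring_1 mat" and u :: "nat \<Rightarrow> int"
  assumes A: "A \<in> carrier_mat n n"
    and zero: "\<And>i j. i < n \<Longrightarrow> j < n \<Longrightarrow> u i < u j \<Longrightarrow> A $$ (i, j) = 0"
  shows "det (mat n n (\<lambda>(i, j). if u i = u j then A $$ (i, j) else 0)) = det A" (is "det ?D = _")
proof -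
  have "(\<Prod>i = 0..<n. ?D $$ (i, p i)) = (\<Prod>i = 0..<n. A $$ (i, p i))" if p: "p permutes {0..<n}" for p
  proof (cases "\<forall>i<n. u (p i) = u i")
    case True
    then show ?thesis using permutes_in_image[OF p] by (intro prod.cong) auto
  next
    case False
    then obtain k where k: "k < n" "u k \<noteq> u (p k)" by auto
    have pn: "p i < n" if "i < n" for i using permutes_in_image[OF p, of i] that by simp
    have sums: "(\<Sum>i = 0..<n. u (p i)) = (\<Sum>i = 0..<n. u i)"
      using sum.permute[OF p, of u] by (simp add: o_def)
    have "\<exists>i<n. u i < u (p i)"
    proof (rule ccontr)
      assume "\<not> ?thesis"
      then have "\<forall>i<n. u (p i) \<le> u i" by (meson not_less)
      then have "u (p k) = u k"
        using k(1) by (intro sum_mono_inv[OF sums]) auto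
      with k(2) show False by simp
    qed
    then obtain i where i: "i < n" "u i < u (p i)" by blast
    have "(\<Prod>i = 0..<n. ?D $$ (i, p i)) = 0" using k pn by (intro prod_zero) auto
    moreover have "(\<Prod>i = 0..<n. A $$ (i, p i)) = 0" using i(1) zero[OF i(1) pn[OF i(1)] i(2)] by (intro prod_zero) auto
    ultimately show ?thesis by simp
  qed
  then show ?thesis
    unfolding det_def'[OF A] by (subst det_def'[of _ n]) (auto intro!: sum.cong)
qed

text \<open>The inverse is the adjugate divided by the constant determinant. Its entries outside the
  blocks of equal weight are set to zero outright: as \<open>D\<close> vanishes there, the remaining entries
  still form an inverse.\<close>

lemma weight_diagonal_inverse:
  fixes D :: "cpoly mat" and u :: "nat \<Rightarrow> int"
  assumes D: "D \<in> carrier_mat n n" and det: "det D = Poly_Mapping.single 0 c" and c: "c \<noteq> 0"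
    and vars: "\<And>i j. i < n \<Longrightarrow> j < n \<Longrightarrow> poly_vars (D $$ (i, j)) \<subseteq> S"
    and diag: "\<And>i j. i < n \<Longrightarrow> j < n \<Longrightarrow> u i \<noteq> u j \<Longrightarrow> D $$ (i, j) = 0"
  obtains N where "\<And>i j. i < n \<Longrightarrow> j < n \<Longrightarrow> poly_vars (N i j) \<subseteq> S"
    "\<And>i j. u i \<noteq> u j \<Longrightarrow> N i j = 0"
    "\<And>i k. i < n \<Longrightarrow> k < n \<Longrightarrow> (\<Sum>j<n. D $$ (i, j) * N j k) = (if i = k then 1 else 0)"
    "\<And>i k. i < n \<Longrightarrow> k < n \<Longrightarrow> (\<Sum>j<n. N i j * D $$ (j, k)) = (if i = k then 1 else 0)"
proof -
  let ?inv = "Poly_Mapping.single 0 (1 / c) :: cpoly"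
  define N where "N i j = (if u i = u j then ?inv * adj_mat D $$ (i, j) else 0)" for i j
  note adj = adj_mat[OF D]
  have cc: "?inv * det D = 1" unfolding det using c by (simp add: mult_single)
  have vars_N: "poly_vars (N i j) \<subseteq> S" if ij: "i < n" "j < n" for i j
  proof -
    have "poly_vars (det (mat_delete D j i)) \<subseteq> S"
    proof (rule poly_vars_det[OF mat_delete_carrier[OF D]])
      fix a b assume ab: "a < n - 1" "b < n - 1"
      have "mat_delete D j i $$ (a, b) = D $$ (if a < j then a else Suc a, if b < i then b else Suc b)"
        using D ab by (simp add: mat_delete_def)
      also have "poly_vars \<dots> \<subseteq> S" using ab by (intro vars) auto
      finally show "poly_vars (mat_delete D j i $$ (a, b)) \<subseteq> S" .
    qed
    then have "poly_vars (adj_mat D $$ (i, j)) \<subseteq> S"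
      using D ij by (cases "even (j + i)") (simp_all add: adj_mat_def cofactor_def)
    then show ?thesis by (simp add: N_def poly_vars_mult poly_vars_single)
  qed
  have off: "N i j = 0" if "u i \<noteq> u j" for i j using that by (simp add: N_def)
  have right: "(\<Sum>j<n. D $$ (i, j) * N j k) = (if i = k then 1 else 0)" if ik: "i < n" "k < n" for i k
  proof (cases "u i = u k")
    case True
    have "(\<Sum>j<n. D $$ (i, j) * N j k) = (\<Sum>j<n. ?inv * (D $$ (i, j) * adj_mat D $$ (j, k)))"
      using True ik diag by (intro sum.cong) (auto simp: N_def mult.left_commute)
    also have "\<dots> = ?inv * (D * adj_mat D) $$ (i, k)"
      using D adj(1) ik by (simp add: scalar_prod_def sum_distrib_left lessThan_atLeast0)
    also have "\<dots> = (if i = k then 1 else 0)" using ik cc by (simp add: adj(2))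
    finally show ?thesis .
  next
    case False
    then have "D $$ (i, j) * N j k = 0" if "j < n" for j
      using ik that by (cases "u i = u j") (simp_all add: diag off)
    then have "(\<Sum>j<n. D $$ (i, j) * N j k) = 0" by (intro sum.neutral) auto
    with False show ?thesis by auto
  qed
  have left: "(\<Sum>j<n. N i j * D $$ (j, k)) = (if i = k then 1 else 0)" if ik: "i < n" "k < n" for i k
  proof (cases "u i = u k")
    case True
    have "(\<Sum>j<n. N i j * D $$ (j, k)) = (\<Sum>j<n. ?inv * (adj_mat D $$ (i, j) * D $$ (j, k)))"
      using True ik diag by (intro sum.cong) (auto simp: N_def mult.left_commute)
    also have "\<dots> = ?inv * (adj_mat D * D) $$ (i, k)"
      using D adj(1) ik by (simp add: scalar_prod_def sum_distrib_left lessThan_atLeast0)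
    also have "\<dots> = (if i = k then 1 else 0)" using ik cc by (simp add: adj(3))
    finally show ?thesis .
  next
    case False
    then have "N i j * D $$ (j, k) = 0" if "j < n" for j
      using ik that by (cases "u i = u j") (simp_all add: diag off)
    then have "(\<Sum>j<n. N i j * D $$ (j, k)) = 0" by (intro sum.neutral) auto
    with False show ?thesis by auto
  qed
  show ?thesis by (rule that[OF vars_N off right left])
qed

section \<open>The Jacobian matrix of a graded map\<close>

text \<open>This is the block diagonal matrix whose block at weight zero is the Jacobian matrix of \<open>F\<close> and
  whose remaining part is the matrix \<open>M(u)\<close> of the introduction.\<close>

definition top_derivs :: "nat \<Rightarrow> int vec \<Rightarrow> cpoly vec \<Rightarrow> cpoly mat" where
  "top_derivs n w G = mat n n (\<lambda>(i, j). if w $ i = w $ j then jacobian n G $$ (i, j) else 0)"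

text \<open>The remainder \<open>P(u, x)\<close> only depends on the variables of smaller weight. The exponents of a
  monomial of \<open>G\<^sub>k\<close> at the variables of weight \<open>w\<^sub>k\<close> have a sum \<open>s\<close>, and \<open>w\<^sub>k s \<le> w\<^sub>k\<close>, so \<open>s\<close> is \<open>0\<close> or
  \<open>1\<close>. By Euler's formula the subtracted sum contains the monomial \<open>s\<close> times: if \<open>s = 1\<close> it cancels,
  and if \<open>s = 0\<close> all its variables have smaller weight.\<close>

lemma poly_eval_minus_top:
  assumes w: "\<forall>i<n. 0 \<le> w $ i" and G: "is_graded_map n w G"
    and k: "k < n" "0 < w $ k"
    and agree: "\<And>i. i < n \<Longrightarrow> w $ i < w $ k \<Longrightarrow> x $ i = x' $ i"
  shows "poly_eval x (G $ k) - (\<Sum>l<n. poly_eval x (top_derivs n w G $$ (k, l)) * x $ l) =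
    poly_eval x' (G $ k) - (\<Sum>l<n. poly_eval x' (top_derivs n w G $$ (k, l)) * x' $ l)"
proof -
  let ?p = "G $ k" and ?L = "{l. l < n \<and> w $ l = w $ k}"
  let ?s = "\<lambda>m. \<Sum>l\<in>?L. Poly_Mapping.lookup m l"
  have hom: "weight_homogeneous w (w $ k) ?p" and vars: "poly_vars ?p \<subseteq> {..<n}"
    using G k unfolding is_graded_map_def is_poly_map_def by auto
  have top: "(\<Sum>l<n. poly_eval y (top_derivs n w G $$ (k, l)) * y $ l) =
      (\<Sum>m\<in>Poly_Mapping.keys ?p. of_nat (?s m) * Poly_Mapping.lookup ?p m * monomial_eval y m)" for y
  proof -
    have "(\<Sum>l<n. poly_eval y (top_derivs n w G $$ (k, l)) * y $ l) =
        (\<Sum>l\<in>?L. poly_eval y (partial_deriv l ?p) * y $ l)"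
      using k by (intro sum.mono_neutral_cong_right) (auto simp: top_derivs_def jacobian_def)
    also have "\<dots> = (\<Sum>m\<in>Poly_Mapping.keys ?p. \<Sum>l\<in>?L.
        of_nat (Poly_Mapping.lookup m l) * Poly_Mapping.lookup ?p m * monomial_eval y m)"
      unfolding poly_eval_euler by (rule sum.swap)
    finally show ?thesis by (simp add: sum_distrib_right)
  qed
  have eq: "Poly_Mapping.lookup ?p m * monomial_eval x m - of_nat (?s m) * Poly_Mapping.lookup ?p m * monomial_eval x m =
      Poly_Mapping.lookup ?p m * monomial_eval x' m - of_nat (?s m) * Poly_Mapping.lookup ?p m * monomial_eval x' m"
    if m: "m \<in> Poly_Mapping.keys ?p" for m
  proof -
    have keys: "Poly_Mapping.keys m \<subseteq> {..<n}" using vars m unfolding poly_vars_subset_iff by (rule bspec)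
    have weight: "monomial_weight w m = w $ k" using hom m unfolding weight_homogeneous_def by (rule bspec)
    have "w $ k * int (?s m) = (\<Sum>i\<in>?L. w $ i * int (Poly_Mapping.lookup m i))"
      by (simp add: sum_distrib_left)
    also have "\<dots> \<le> w $ k * 1"
      using weight_part_le[OF w keys, of ?L] weight by auto
    finally have "int (?s m) \<le> 1" using k(2) by (simp only: mult_le_cancel_left_pos)
    then consider "?s m = 1" | "?s m = 0" by linarith
    then show ?thesis
    proof cases
      case 1
      then show ?thesis by (simp only: of_nat_1) simp
    next
      case 2
      have "monomial_eval x m = monomial_eval x' m"
        unfolding monomial_eval_def
      proof (rule prod.cong)
        fix i assume i: "i \<in> Poly_Mapping.keys m"
        then have "i < n" using keys by auto
        have "w $ i \<noteq> w $ k"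
        proof
          assume "w $ i = w $ k"
          with 2 \<open>i < n\<close> have "Poly_Mapping.lookup m i = 0" by simp
          with i show False by (simp add: in_keys_iff)
        qed
        with weight_var_le[OF w keys i] weight have "w $ i < w $ k" by simp
        then show "(x $ i) ^ Poly_Mapping.lookup m i = (x' $ i) ^ Poly_Mapping.lookup m i"
          using agree[OF \<open>i < n\<close>] by simp
      qed simp
      then show ?thesis by simp
    qed
  qed
  show ?thesis
    unfolding top unfolding poly_eval_alt sum_subtractf[symmetric] by (rule sum.cong[OF refl eq])
qed

lemma is_graded_mapD:
  assumes "is_graded_map n w G" "j < n"
  shows "poly_vars (G $ j) \<subseteq> {..<n}" "weight_homogeneous w (w $ j) (G $ j)" "is_poly_map n G"
  using assms by (auto simp: is_graded_map_def is_poly_map_def)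

lemma jacobian_upper_weight_zero:
  assumes w: "\<forall>i<n. 0 \<le> w $ i" and G: "is_graded_map n w G" and ij: "i < n" "j < n" "w $ i < w $ j"
  shows "jacobian n G $$ (i, j) = 0"
proof -
  have "j \<notin> poly_vars (G $ i)"
    using weight_homogeneous_var_le[OF w is_graded_mapD(1,2)[OF G ij(1)], of j] ij(3) by auto
  then show ?thesis using ij by (simp add: jacobian_def partial_deriv_eq_0)
qed

lemma det_top_derivs:
  assumes "\<forall>i<n. 0 \<le> w $ i" "is_graded_map n w G"
  shows "det (top_derivs n w G) = det (jacobian n G)"
  unfolding top_derivs_def
proof (rule det_weight_diagonal)
  show "jacobian n G \<in> carrier_mat n n" by (simp add: jacobian_def)
qed (rule jacobian_upper_weight_zero[OF assms])

lemma poly_vars_top_derivs: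
  assumes w: "\<forall>i<n. 0 \<le> w $ i" and G: "is_graded_map n w G" and ij: "i < n" "j < n"
  shows "poly_vars (top_derivs n w G $$ (i, j)) \<subseteq> {l. l < n \<and> w $ l = 0}"
proof (cases "w $ i = w $ j")
  case True
  let ?p = "partial_deriv j (G $ i)"
  have hom: "weight_homogeneous w 0 ?p"
    using weight_homogeneous_partial_deriv[OF is_graded_mapD(2)[OF G ij(1)], of j] True by simp
  have vars: "poly_vars ?p \<subseteq> {..<n}"
    by (rule poly_vars_partial_deriv[OF is_graded_mapD(1)[OF G ij(1)]])
  have "poly_vars ?p \<subseteq> {l. l < n \<and> w $ l = 0}"
  proof
    fix l assume l: "l \<in> poly_vars ?p"
    with vars have "l < n" by auto
    with w weight_homogeneous_var_le[OF w vars hom l] show "l \<in> {l. l < n \<and> w $ l = 0}" by force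
  qed
  with True ij show ?thesis by (simp add: top_derivs_def jacobian_def)
qed (use ij in \<open>simp add: top_derivs_def\<close>)

lemma poly_vars_weight_zero_part:
  assumes w: "\<forall>i<n. 0 \<le> w $ i" and G: "is_graded_map n w G" and j: "j < n" "w $ j = 0"
  shows "poly_vars (G $ j) \<subseteq> {l. l < n \<and> w $ l = 0}"
proof
  fix l assume l: "l \<in> poly_vars (G $ j)"
  note g = is_graded_mapD[OF G j(1)]
  from l g(1) have "l < n" by auto
  with w weight_homogeneous_var_le[OF w g(1,2) l] j(2) show "l \<in> {l. l < n \<and> w $ l = 0}" by force
qed

section \<open>Inverting a graded map over its weight-zero part\<close>

text \<open>One Newton step for the equation \<open>G x = y\<close>, where \<open>N\<close> is the inverse of \<open>top_derivs\<close> and \<open>h\<close>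
  already gives the solution in the coordinates of weight zero. In the notation of the
  introduction its part of positive weight is \<open>M(u)\<^sup>-\<^sup>1 (y - P(u, x))\<close>, but in the form below its fixed points
  are visibly the solutions.\<close>

definition newton_step ::
  "nat \<Rightarrow> int vec \<Rightarrow> cpoly vec \<Rightarrow> (nat \<Rightarrow> nat \<Rightarrow> cpoly) \<Rightarrow> (complex vec \<Rightarrow> nat \<Rightarrow> complex) \<Rightarrow> complex vec \<Rightarrow> complex vec \<Rightarrow> complex vec"
where
  "newton_step n w G N h y x = vec n (\<lambda>j. if w $ j = 0 then h y j
     else x $ j + (\<Sum>k<n. poly_eval x (N j k) * (y $ k - poly_eval x (G $ k))))"

lemma newton_step_index:
  assumes "j < n" "w $ j \<noteq> 0"
  shows "newton_step n w G N h y x $ j = x $ j + (\<Sum>k<n. poly_eval x (N j k) * (y $ k - poly_eval x (G $ k)))"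
  using assms by (simp add: newton_step_def)

text \<open>Each Newton step makes one more weight independent of the starting point, since
  \<open>y - P(u, x)\<close> only involves coordinates of \<open>x\<close> of smaller weight.\<close>

lemma newton_step_agree:
  assumes w: "\<forall>i<n. 0 \<le> w $ i" and G: "is_graded_map n w G"
    and N_vars: "\<And>i j. i < n \<Longrightarrow> j < n \<Longrightarrow> poly_vars (N i j) \<subseteq> {l. l < n \<and> w $ l = 0}"
    and N_off: "\<And>i j. w $ i \<noteq> w $ j \<Longrightarrow> N i j = 0"
    and N_left: "\<And>i k. i < n \<Longrightarrow> k < n \<Longrightarrow> (\<Sum>j<n. N i j * top_derivs n w G $$ (j, k)) = (if i = k then 1 else 0)"
    and agree: "\<And>i. i < n \<Longrightarrow> w $ i < d \<Longrightarrow> x $ i = x' $ i"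
    and j: "j < n" "w $ j < d + 1"
  shows "newton_step n w G N h y x $ j = newton_step n w G N h y x' $ j"
proof (cases "w $ j = 0")
  case True
  then show ?thesis using j by (simp add: newton_step_def)
next
  case False
  with w j have pos: "0 < w $ j" by (simp add: order_less_le)
  \<comment> \<open>Because \<open>N\<close> inverts the block diagonal matrix, the linear part of \<open>G\<close> cancels the leading \<open>x\<^sub>j\<close>.\<close>
  define P where "P x k = poly_eval x (G $ k) - (\<Sum>l<n. poly_eval x (top_derivs n w G $$ (k, l)) * x $ l)" for x k
  have step: "newton_step n w G N h y v $ j = (\<Sum>k<n. poly_eval v (N j k) * (y $ k - P v k))" for v
  proof -
    have "(\<Sum>k<n. poly_eval v (N j k) * (\<Sum>l<n. poly_eval v (top_derivs n w G $$ (k, l)) * v $ l)) =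
        (\<Sum>l<n. (\<Sum>k<n. poly_eval v (N j k) * poly_eval v (top_derivs n w G $$ (k, l))) * v $ l)"
      unfolding sum_distrib_left sum_distrib_right mult.assoc[symmetric] by (rule sum.swap)
    also have "\<dots> = (\<Sum>l<n. poly_eval v (\<Sum>k<n. N j k * top_derivs n w G $$ (k, l)) * v $ l)"
      by (simp add: poly_eval_sum poly_eval_mult)
    also have "\<dots> = (\<Sum>l<n. if l = j then v $ l else 0)"
      using j by (intro sum.cong) (auto simp: N_left)
    also have "\<dots> = v $ j" using j by simp
    finally have lin: "v $ j = (\<Sum>k<n. poly_eval v (N j k) * (\<Sum>l<n. poly_eval v (top_derivs n w G $$ (k, l)) * v $ l))"
      by simp
    have "newton_step n w G N h y v $ j = v $ j + (\<Sum>k<n. poly_eval v (N j k) * (y $ k - poly_eval v (G $ k)))"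
      using False j by (simp add: newton_step_def)
    also have "\<dots> = (\<Sum>k<n. poly_eval v (N j k) * (y $ k - P v k))"
      by (subst lin) (simp add: P_def sum.distrib[symmetric] algebra_simps)
    finally show ?thesis .
  qed
  have "poly_eval x (N j k) * (y $ k - P x k) = poly_eval x' (N j k) * (y $ k - P x' k)" if k: "k < n" for k
  proof (cases "w $ k = w $ j")
    case True
    have "poly_eval x (N j k) = poly_eval x' (N j k)"
    proof (rule poly_eval_cong)
      fix l assume "l \<in> poly_vars (N j k)"
      with N_vars[OF j(1) k] have "l < n" "w $ l = 0" by auto
      with agree pos j(2) show "x $ l = x' $ l" by simp
    qed
    moreover have "P x k = P x' k"
      unfolding P_def
      by (rule poly_eval_minus_top[OF w G k]) (use True pos j(2) agree in auto)
    ultimately show ?thesis by simp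
  next
    case False
    then have "N j k = 0" by (intro N_off) auto
    then show ?thesis by simp
  qed
  then show ?thesis unfolding step by simp
qed

text \<open>After more Newton steps than the largest weight, the result no longer depends on the starting
  point. It is then the unique fixed point of the step, that is, the unique solution of \<open>G x = y\<close>, and as
  a finite iterate it is polynomial in \<open>y\<close>. So existence and uniqueness of the solution and
  polynomiality of the inverse are obtained at once.\<close>

lemma graded_automorphism_if_weight_zero_part:
  assumes w: "\<forall>i<n. 0 \<le> w $ i" and G: "is_graded_map n w G"
    and det: "det (jacobian n G) = Poly_Mapping.single 0 c" and c: "c \<noteq> 0"
    and p: "p permutes {0..<n}" and z: "z \<le> n" and pz: "\<And>i. i < n \<Longrightarrow> w $ p i = 0 \<longleftrightarrow> i < z"
    and F: "is_poly_automorphism z (vec z (\<lambda>a. rename_vars (inv_into UNIV p) (G $ p a)))" (is "is_poly_automorphism z ?F")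
  shows "is_poly_automorphism n G"
proof -
  let ?q = "inv_into UNIV p" and ?D = "top_derivs n w G"
  have q: "bij ?q" using permutes_bij[OF p] by (rule bij_imp_bij_inv)
  have pq: "p (?q i) = i" "?q (p i) = i" for i using permutes_inverses[OF p] by auto
  have pn: "p i < n \<longleftrightarrow> i < n" and qn: "?q i < n \<longleftrightarrow> i < n" for i
    using permutes_in_image[OF p, of i] permutes_in_image[OF permutes_inv[OF p], of i] by auto
  have qz: "?q i < z \<longleftrightarrow> w $ i = 0" if "i < n" for i using pz[of "?q i"] that by (simp add: qn pq)
  have Gmap: "is_poly_map n G" using G by (simp add: is_graded_map_def)
  obtain N where N_vars: "\<And>i j. i < n \<Longrightarrow> j < n \<Longrightarrow> poly_vars (N i j) \<subseteq> {l. l < n \<and> w $ l = 0}"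
    and N_off: "\<And>i j. w $ i \<noteq> w $ j \<Longrightarrow> N i j = 0"
    and N_right: "\<And>i k. i < n \<Longrightarrow> k < n \<Longrightarrow> (\<Sum>j<n. ?D $$ (i, j) * N j k) = (if i = k then 1 else 0)"
    and N_left: "\<And>i k. i < n \<Longrightarrow> k < n \<Longrightarrow> (\<Sum>j<n. N i j * ?D $$ (j, k)) = (if i = k then 1 else 0)"
  proof (rule weight_diagonal_inverse[of ?D n c "{l. l < n \<and> w $ l = 0}" "\<lambda>i. w $ i"])
    show "?D \<in> carrier_mat n n" by (simp add: top_derivs_def)
    show "det ?D = Poly_Mapping.single 0 c" using det_top_derivs[OF w G] det by simp
    show "poly_vars (?D $$ (i, j)) \<subseteq> {l. l < n \<and> w $ l = 0}" if "i < n" "j < n" for i j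
      by (rule poly_vars_top_derivs[OF w G that])
    show "?D $$ (i, j) = 0" if "i < n" "j < n" "w $ i \<noteq> w $ j" for i j
      using that by (simp add: top_derivs_def)
  qed (use c in auto)
  obtain H where H: "is_poly_map z H" "\<And>u. u \<in> carrier_vec z \<Longrightarrow> map_eval H (map_eval ?F u) = u"
    "\<And>v. v \<in> carrier_vec z \<Longrightarrow> map_eval ?F (map_eval H v) = v"
    using F by (rule poly_automorphismE) blast
  define proj where "proj x = vec z (\<lambda>a. x $ p a)" for x :: "complex vec"
  have proj: "proj x \<in> carrier_vec z" for x by (simp add: proj_def)
  \<comment> \<open>\<open>F\<close> describes \<open>G\<close> on the weight-zero coordinates, so \<open>H\<close> determines those of a preimage.\<close>
  have F_proj: "map_eval ?F (proj x) = proj (map_eval G x)" for x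
  proof (rule eq_vecI)
    fix a assume "a < dim_vec (proj (map_eval G x))"
    then have a: "a < z" "p a < n" "w $ p a = 0" using z pz by (auto simp: proj_def pn)
    have "poly_eval (proj x) (rename_vars ?q (G $ p a)) = poly_eval x (G $ p a)"
    proof (rule poly_eval_rename_vars[OF q])
      fix i assume "i \<in> poly_vars (G $ p a)"
      then have "i < n" "w $ i = 0" using poly_vars_weight_zero_part[OF w G a(2,3)] by auto
      then show "x $ i = proj x $ ?q i" by (simp add: proj_def qz pq)
    qed
    then show "map_eval ?F (proj x) $ a = proj (map_eval G x) $ a"
      using a by (simp add: map_eval_index[OF Gmap] proj_def) (simp add: map_eval_def)
  qed (simp add: proj_def map_eval_def)
  define h where "h y j = map_eval H (proj y) $ ?q j" for y j
  let ?T = "newton_step n w G N h"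
  have T_carrier: "?T y x \<in> carrier_vec n" for y x by (simp add: newton_step_def)
  have fixed: "?T (map_eval G x) x = x" if x: "x \<in> carrier_vec n" for x
  proof (rule eq_vecI)
    fix j assume "j < dim_vec x"
    then have j: "j < n" using x by simp
    have "h (map_eval G x) j = proj x $ ?q j"
      unfolding h_def F_proj[symmetric] H(2)[OF proj] ..
    then have "h (map_eval G x) j = x $ j" if "w $ j = 0"
      using j that by (simp add: proj_def qz pq)
    then show "?T (map_eval G x) x $ j = x $ j"
      using j by (simp add: newton_step_def map_eval_index[OF Gmap])
  qed (use x in \<open>simp add: newton_step_def\<close>)
  have solves: "map_eval G x = y" if x: "?T y x = x" and y: "y \<in> carrier_vec n" for x y
  proof -
    define e where "e k = y $ k - poly_eval x (G $ k)" for k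
    have T: "x $ j = (if w $ j = 0 then h y j else x $ j + (\<Sum>k<n. poly_eval x (N j k) * e k))" if "j < n" for j
    proof -
      have "?T y x $ j = (if w $ j = 0 then h y j else x $ j + (\<Sum>k<n. poly_eval x (N j k) * e k))"
        using that by (simp add: newton_step_def e_def)
      then show ?thesis unfolding x .
    qed
    have "proj x = map_eval H (proj y)"
    proof (rule eq_vecI)
      fix a assume "a < dim_vec (map_eval H (proj y))"
      then have a: "a < z" using map_eval_carrier[OF H(1), of "proj y"] by simp
      then have "p a < n" "w $ p a = 0" using z pz by (auto simp: pn)
      then show "proj x $ a = map_eval H (proj y) $ a"
        using T[of "p a"] a by (simp add: proj_def h_def pq)
    qed (use map_eval_carrier[OF H(1), of "proj y"] in \<open>simp add: proj_def\<close>)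
    then have Gx: "proj (map_eval G x) = proj y" using F_proj H(3)[OF proj] by metis
    have e0: "e k = 0" if k: "k < n" "w $ k = 0" for k
    proof -
      have "proj (map_eval G x) $ ?q k = proj y $ ?q k" unfolding Gx ..
      then show ?thesis using k by (simp add: proj_def qz pq map_eval_index[OF Gmap] e_def)
    qed
    have Ne: "(\<Sum>k<n. poly_eval x (N j k) * e k) = 0" if j: "j < n" for j
    proof (cases "w $ j = 0")
      case True
      have "poly_eval x (N j k) * e k = 0" if "k < n" for k
        using N_off[of j k] e0[OF that] True by (cases "w $ k = 0") auto
      then show ?thesis by (intro sum.neutral) auto
    next
      case False
      then show ?thesis using T[OF j] by simp
    qed
    have "e i = 0" if i: "i < n" for i
    proof -
      have "0 = (\<Sum>j<n. poly_eval x (?D $$ (i, j)) * (\<Sum>k<n. poly_eval x (N j k) * e k))"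
        by (simp add: Ne)
      also have "\<dots> = (\<Sum>k<n. (\<Sum>j<n. poly_eval x (?D $$ (i, j)) * poly_eval x (N j k)) * e k)"
        unfolding sum_distrib_left sum_distrib_right mult.assoc[symmetric] by (rule sum.swap)
      also have "\<dots> = (\<Sum>k<n. poly_eval x (\<Sum>j<n. ?D $$ (i, j) * N j k) * e k)"
        by (simp add: poly_eval_sum poly_eval_mult)
      also have "\<dots> = (\<Sum>k<n. if k = i then e k else 0)"
        using i by (intro sum.cong) (auto simp: N_right)
      finally show ?thesis using i by simp
    qed
    then show ?thesis
      using y map_eval_carrier[OF Gmap, of x]
      by (intro eq_vecI) (auto simp: map_eval_index[OF Gmap] e_def)
  qed
  \<comment> \<open>A bound exceeding all weights; the inserted \<open>0\<close> keeps the maximum defined for \<open>n = 0\<close>.\<close>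
  define M where "M = nat (Max (insert 0 ((\<lambda>i. w $ i) ` {..<n}))) + 1"
  have M: "w $ i < int M" if "i < n" for i
  proof -
    have "w $ i \<le> Max (insert 0 ((\<lambda>i. w $ i) ` {..<n}))" using that by (intro Max_ge) auto
    then show ?thesis by (simp add: M_def)
  qed
  have iterate_agree: "((?T y ^^ m) x) $ i = ((?T y ^^ m) x') $ i" if "i < n" "w $ i < int m" for m i x x' y
    using that
  proof (induction m arbitrary: i)
    case 0
    then show ?case using w by (simp add: leD)
  next
    case (Suc m)
    then show ?case
      by (simp del: of_nat_Suc) (rule newton_step_agree[OF w G N_vars N_off N_left, where d = "int m"], auto)
  qed
  have iterate_carrier: "(?T y ^^ m) x \<in> carrier_vec n" if "x \<in> carrier_vec n" for m x y
    using that by (cases m) (auto simp: T_carrier)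
  have const: "(?T y ^^ M) x = (?T y ^^ M) x'" if "x \<in> carrier_vec n" "x' \<in> carrier_vec n" for x x' y
    using iterate_carrier[OF that(1), of M y] iterate_carrier[OF that(2), of M y]
    by (intro eq_vecI) (auto intro!: iterate_agree M)
  define g where "g j y = (?T y ^^ M) (0\<^sub>v n) $ j" for j y
  have g: "vec n (\<lambda>j. g j y) = (?T y ^^ M) (0\<^sub>v n)" for y
    using iterate_carrier[of "0\<^sub>v n" M y] by (intro eq_vecI) (auto simp: g_def)
  have poly_h: "polynomial_function n (\<lambda>y. h y j)" if j: "j < n" "w $ j = 0" for j
  proof -
    have qj: "?q j < z" using j qz by simp
    have vars: "poly_vars (H $ ?q j) \<subseteq> {..<z}" using H(1) qj by (simp add: is_poly_map_def)
    have "polynomial_function n (\<lambda>y. poly_eval (proj y) (H $ ?q j))"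
    proof (rule polynomial_function_compose)
      fix i assume "i \<in> poly_vars (H $ ?q j)"
      then have i: "i < z" using vars by auto
      then have "p i < n" using z by (simp add: pn)
      then show "polynomial_function n (\<lambda>y. proj y $ i)"
        using i polynomial_function_coord by (simp add: proj_def)
    qed
    then show ?thesis unfolding h_def map_eval_index[OF H(1) qj] .
  qed
  have poly_iterate: "polynomial_function n (\<lambda>y. (?T y ^^ m) (0\<^sub>v n) $ j)" if "j < n" for m j
    using that
  proof (induction m arbitrary: j)
    case 0
    then show ?case by (simp add: polynomial_function_const)
  next
    case (Suc m)
    have comp: "polynomial_function n (\<lambda>y. poly_eval ((?T y ^^ m) (0\<^sub>v n)) r)" if "poly_vars r \<subseteq> {..<n}" for r
      by (rule polynomial_function_compose) (use that Suc.IH in auto)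
    have Nv: "poly_vars (N j k) \<subseteq> {..<n}" if "k < n" for k using N_vars[OF Suc.prems that] by auto
    show ?case
    proof (cases "w $ j = 0")
      case True
      then show ?thesis using Suc.prems poly_h by (simp add: newton_step_def)
    next
      case False
      have "polynomial_function n (\<lambda>y. (?T y ^^ m) (0\<^sub>v n) $ j + (\<Sum>k<n. poly_eval ((?T y ^^ m) (0\<^sub>v n)) (N j k) *
          (y $ k - poly_eval ((?T y ^^ m) (0\<^sub>v n)) (G $ k))))"
        by (intro polynomial_function_add polynomial_function_sum polynomial_function_mult
            polynomial_function_diff polynomial_function_coord comp Suc.IH Suc.prems Nv is_graded_mapD(1)[OF G]) auto
      then show ?thesis using newton_step_index[OF Suc.prems False] by simp
    qed
  qed
  show ?thesis
  proof (rule poly_automorphismI[OF Gmap, of g])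
    show "polynomial_function n (g j)" if "j < n" for j
      using poly_iterate[OF that, of M] by (simp add: g_def[abs_def])
    show "vec n (\<lambda>j. g j (map_eval G x)) = x" if x: "x \<in> carrier_vec n" for x
    proof -
      have "(?T (map_eval G x) ^^ m) x = x" for m by (induction m) (simp_all add: fixed[OF x])
      then show ?thesis unfolding g by (metis const x zero_carrier_vec)
    qed
    show "map_eval G (vec n (\<lambda>j. g j y)) = y" if y: "y \<in> carrier_vec n" for y
    proof (rule solves[OF _ y])
      have "?T y ((?T y ^^ M) (0\<^sub>v n)) = (?T y ^^ M) (?T y (0\<^sub>v n))"
        by (simp add: funpow_swap1)
      also have "\<dots> = (?T y ^^ M) (0\<^sub>v n)" by (rule const) (auto simp: T_carrier)
      finally show "?T y (vec n (\<lambda>j. g j y)) = vec n (\<lambda>j. g j y)" unfolding g .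
    qed
  qed
qed

section \<open>Weight-zero parts and stabilization\<close>

text \<open>The rows of weight zero of the Jacobian matrix vanish outside the columns of weight zero, so
  \<open>det JF\<close> is a factor of the constant \<open>det JG\<close>.\<close>

lemma keller_weight_zero_part:
  assumes w: "\<forall>i<n. 0 \<le> w $ i" and G: "is_graded_map n w G"
    and det: "det (jacobian n G) = Poly_Mapping.single 0 c" and c: "c \<noteq> 0"
    and p: "p permutes {0..<n}" and z: "z \<le> n" and pz: "\<And>i. i < n \<Longrightarrow> w $ p i = 0 \<longleftrightarrow> i < z"
  shows "is_keller_map z (vec z (\<lambda>a. rename_vars (inv_into UNIV p) (G $ p a)))" (is "is_keller_map z ?F")
proof -
  let ?q = "inv_into UNIV p"
  have q: "bij ?q" using permutes_bij[OF p] by (rule bij_imp_bij_inv)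
  have pq: "p (?q i) = i" "?q (p i) = i" for i using permutes_inverses[OF p] by auto
  have pn: "p i < n \<longleftrightarrow> i < n" and qn: "?q i < n \<longleftrightarrow> i < n" for i
    using permutes_in_image[OF p, of i] permutes_in_image[OF permutes_inv[OF p], of i] by auto
  have qz: "?q i < z" if "i < n" "w $ i = 0" for i using pz[of "?q i"] that by (simp add: qn pq)
  let ?A = "mat z z (\<lambda>(i, j). jacobian n G $$ (p i, p j))"
  have "det (jacobian n G) = det ?A *
      det (mat (n - z) (n - z) (\<lambda>(i, j). jacobian n G $$ (p (z + i), p (z + j))))"
  proof (rule det_block_triangular[OF _ p z])
    show "jacobian n G \<in> carrier_mat n n" by (simp add: jacobian_def)
    fix i j assume ij: "i < z" "z \<le> j" "j < n"
    then have "w $ p i = 0" "w $ p j \<noteq> 0" "p i < n" "p j < n" using pz z by (auto simp: pn)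
    moreover from this w have "w $ p i < w $ p j" by (simp add: order_less_le)
    ultimately show "jacobian n G $$ (p i, p j) = 0" by (intro jacobian_upper_weight_zero[OF w G])
  qed
  with det have "det ?A * det (mat (n - z) (n - z) (\<lambda>(i, j). jacobian n G $$ (p (z + i), p (z + j)))) =
      Poly_Mapping.single 0 c" by simp
  then obtain d where d: "d \<noteq> 0" "det ?A = Poly_Mapping.single 0 d" using factor_of_constant_is_constant c by blast
  have "jacobian z ?F = map_mat (rename_vars ?q) ?A"
  proof (rule eq_matI)
    fix i j assume "i < dim_row (map_mat (rename_vars ?q) ?A)" "j < dim_col (map_mat (rename_vars ?q) ?A)"
    then have ij: "i < z" "j < z" by auto
    then have "p i < n" "p j < n" using z by (auto simp: pn)
    then show "jacobian z ?F $$ (i, j) = map_mat (rename_vars ?q) ?A $$ (i, j)"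
      using ij partial_deriv_rename_vars[OF q, of "p j" "G $ p i"] by (simp add: jacobian_def pq)
  qed (auto simp: jacobian_def)
  then have "det (jacobian z ?F) = rename_vars ?q (det ?A)"
    by (simp add: comm_ring_hom.hom_det[OF rename_vars_hom[OF q]])
  then have det_F: "det (jacobian z ?F) = Poly_Mapping.single 0 d"
    unfolding d(2) by (simp add: rename_vars_const[OF q])
  have "is_poly_map z ?F"
    unfolding is_poly_map_def
  proof (intro conjI allI impI)
    fix a assume a: "a < z"
    then have "p a < n" "w $ p a = 0" using z pz by (auto simp: pn)
    then have "poly_vars (rename_vars ?q (G $ p a)) \<subseteq> ?q ` {l. l < n \<and> w $ l = 0}"
      by (intro poly_vars_rename_vars[OF q] poly_vars_weight_zero_part[OF w G])
    also have "\<dots> \<subseteq> {..<z}" using qz by auto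
    finally show "poly_vars (?F $ a) \<subseteq> {..<z}" using a by simp
  qed simp
  with det_F d(1) show ?thesis unfolding is_keller_map_def by blast
qed

lemma weight_homogeneous_zero:
  assumes "poly_vars r \<subseteq> {l. w $ l = 0}"
  shows "weight_homogeneous w 0 r"
  unfolding weight_homogeneous_def
proof
  fix m assume "m \<in> Poly_Mapping.keys r"
  with assms have "Poly_Mapping.keys m \<subseteq> {l. w $ l = 0}" unfolding poly_vars_subset_iff by (rule bspec)
  then show "monomial_weight w m = 0" unfolding monomial_weight_def by (intro sum.neutral) auto
qed

text \<open>The witness is \<open>F \<times> id\<close>, with the variables of \<open>F\<close> placed at the weight-zero indices. If it
  had a polynomial inverse, then restricting that inverse to \<open>x = 0\<close> and projecting it to the
  weight-zero coordinates would invert \<open>F\<close>.\<close>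

lemma graded_keller_stabilization:
  assumes F: "is_keller_map z F" "\<not> is_poly_automorphism z F"
    and p: "p permutes {0..<n}" and z: "z \<le> n" and pz: "\<And>i. i < n \<Longrightarrow> w $ p i = 0 \<longleftrightarrow> i < z"
  shows "\<exists>E. E \<in> graded_keller_maps n w"
proof -
  let ?q = "inv_into UNIV p"
  have bp: "bij p" by (rule permutes_bij[OF p])
  have pq: "p (?q i) = i" "?q (p i) = i" for i using permutes_inverses[OF p] by auto
  have pn: "p i < n \<longleftrightarrow> i < n" and qn: "?q i < n \<longleftrightarrow> i < n" for i
    using permutes_in_image[OF p, of i] permutes_in_image[OF permutes_inv[OF p], of i] by auto
  have qz: "?q i < z \<longleftrightarrow> w $ i = 0" if "i < n" for i using pz[of "?q i"] that by (simp add: qn pq)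
  obtain c where c: "c \<noteq> 0" "det (jacobian z F) = Poly_Mapping.single 0 c" and Fmap: "is_poly_map z F"
    using F(1) unfolding is_keller_map_def by blast
  have F_vars: "poly_vars (F $ a) \<subseteq> {..<z}" if "a < z" for a using Fmap that by (simp add: is_poly_map_def)
  define E where "E = vec n (\<lambda>j. if ?q j < z then rename_vars p (F $ ?q j)
    else Poly_Mapping.single (Poly_Mapping.single j 1) 1)"
  have E_low: "E $ p i = rename_vars p (F $ i)" if "i < z" for i
    using that z by (simp add: E_def pn pq)
  have E_high: "E $ j = Poly_Mapping.single (Poly_Mapping.single j 1) 1" if "j < n" "\<not> ?q j < z" for j
    using that by (simp add: E_def)
  have vars_low: "poly_vars (rename_vars p (F $ i)) \<subseteq> p ` {..<z}" if "i < z" for i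
    by (rule poly_vars_rename_vars[OF bp F_vars[OF that]])
  have Emap: "is_poly_map n E"
    unfolding is_poly_map_def
  proof (intro conjI allI impI)
    fix j assume j: "j < n"
    show "poly_vars (E $ j) \<subseteq> {..<n}"
    proof (cases "?q j < z")
      case True
      then have "poly_vars (E $ j) \<subseteq> p ` {..<z}" using E_low[OF True] vars_low[OF True] by (simp add: pq)
      also have "\<dots> \<subseteq> {..<n}" using z by (auto simp: pn)
      finally show ?thesis .
    next
      case False
      then show ?thesis unfolding E_high[OF j False] using j by (intro poly_vars_single) simp
    qed
  qed (simp add: E_def)
  have graded: "is_graded_map n w E"
    unfolding is_graded_map_def
  proof (intro conjI allI impI Emap)
    fix j assume j: "j < n"
    show "weight_homogeneous w (w $ j) (E $ j)"
    proof (cases "?q j < z")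
      case True
      have "p ` {..<z} \<subseteq> {l. w $ l = 0}" using pz z by auto
      with vars_low[OF True] have "weight_homogeneous w 0 (rename_vars p (F $ ?q j))"
        by (intro weight_homogeneous_zero) blast
      then show ?thesis using True j E_low[OF True] qz by (simp add: pq)
    next
      case False
      then show ?thesis unfolding E_high[OF j False] by (simp add: weight_homogeneous_def)
    qed
  qed
  let ?J = "jacobian n E"
  have J: "?J $$ (p i, p j) = partial_deriv (p j) (E $ p i)" if "i < n" "j < n" for i j
    using that by (simp add: jacobian_def pn)
  have "det ?J = det (mat z z (\<lambda>(i, j). ?J $$ (p i, p j))) *
      det (mat (n - z) (n - z) (\<lambda>(i, j). ?J $$ (p (z + i), p (z + j))))"
  proof (rule det_block_triangular[OF _ p z])
    show "?J \<in> carrier_mat n n" by (simp add: jacobian_def)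
    fix i j assume ij: "i < z" "z \<le> j" "j < n"
    then have "p j \<notin> p ` {..<z}" using inj_image_mem_iff[OF bij_is_inj[OF bp], of j "{..<z}"] by simp
    then have "p j \<notin> poly_vars (E $ p i)" using vars_low[OF ij(1)] E_low[OF ij(1)] by auto
    then show "?J $$ (p i, p j) = 0" using ij z by (simp add: J partial_deriv_eq_0)
  qed
  also have "mat z z (\<lambda>(i, j). ?J $$ (p i, p j)) = map_mat (rename_vars p) (jacobian z F)"
  proof (rule eq_matI)
    fix i j assume "i < dim_row (map_mat (rename_vars p) (jacobian z F))" "j < dim_col (map_mat (rename_vars p) (jacobian z F))"
    then have ij: "i < z" "j < z" by (auto simp: jacobian_def)
    then show "mat z z (\<lambda>(i, j). ?J $$ (p i, p j)) $$ (i, j) = map_mat (rename_vars p) (jacobian z F) $$ (i, j)"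
      using z by (simp add: J E_low partial_deriv_rename_vars[OF bp]) (simp add: jacobian_def)
  qed (auto simp: jacobian_def)
  also have "mat (n - z) (n - z) (\<lambda>(i, j). ?J $$ (p (z + i), p (z + j))) = 1\<^sub>m (n - z)"
  proof (rule eq_matI)
    fix i j assume "i < dim_row (1\<^sub>m (n - z))" "j < dim_col (1\<^sub>m (n - z))"
    then have ij: "z + i < n" "z + j < n" "i < n - z" "j < n - z" by auto
    then show "mat (n - z) (n - z) (\<lambda>(i, j). ?J $$ (p (z + i), p (z + j))) $$ (i, j) = 1\<^sub>m (n - z) $$ (i, j)"
      using bij_is_inj[OF bp] by (simp add: J E_high pn pq partial_deriv_variable inj_eq del: One_nat_def)
  qed auto
  also have "det (map_mat (rename_vars p) (jacobian z F)) * det (1\<^sub>m (n - z)) = Poly_Mapping.single 0 c"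
    by (simp add: comm_ring_hom.hom_det[OF rename_vars_hom[OF bp]] c(2) rename_vars_const[OF bp])
  finally have keller: "is_keller_map n E" using Emap c(1) unfolding is_keller_map_def by blast
  have "\<not> is_poly_automorphism n E"
  proof
    assume "is_poly_automorphism n E"
    then obtain H where H: "is_poly_map n H" "\<And>x. x \<in> carrier_vec n \<Longrightarrow> map_eval H (map_eval E x) = x"
      "\<And>y. y \<in> carrier_vec n \<Longrightarrow> map_eval E (map_eval H y) = y"
      by (rule poly_automorphismE) blast
    define incl where "incl y = vec n (\<lambda>j. if ?q j < z then y $ ?q j else 0)" for y :: "complex vec"
    define proj where "proj x = vec z (\<lambda>a. x $ p a)" for x :: "complex vec"
    have incl: "incl y \<in> carrier_vec n" for y by (simp add: incl_def)
    have proj_incl: "proj (incl y) = y" if "y \<in> carrier_vec z" for y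
      using that z by (intro eq_vecI) (auto simp: proj_def incl_def pn pq)
    have E_incl: "map_eval E (incl x) = incl (map_eval F x)" for x
    proof (rule eq_vecI)
      fix j assume "j < dim_vec (incl (map_eval F x))"
      then have j: "j < n" by (simp add: incl_def)
      show "map_eval E (incl x) $ j = incl (map_eval F x) $ j"
      proof (cases "?q j < z")
        case True
        have "poly_eval (incl x) (rename_vars p (F $ ?q j)) = poly_eval x (F $ ?q j)"
        proof (rule poly_eval_rename_vars[OF bp])
          fix i assume "i \<in> poly_vars (F $ ?q j)"
          then have "i < z" using F_vars[OF True] by auto
          then show "x $ i = incl x $ p i" using z by (simp add: incl_def pn pq)
        qed
        then show ?thesis
          using True j E_low[OF True] by (simp add: map_eval_index[OF Emap] pq) (simp add: incl_def map_eval_index[OF Fmap])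
      next
        case False
        then show ?thesis using j by (simp add: map_eval_index[OF Emap] E_high) (simp add: incl_def)
      qed
    qed (use map_eval_carrier[OF Emap, of "incl x"] in \<open>simp add: incl_def\<close>)
    have F_proj: "map_eval F (proj x) = proj (map_eval E x)" for x
    proof (rule eq_vecI)
      fix a assume "a < dim_vec (proj (map_eval E x))"
      then have a: "a < z" by (simp add: proj_def)
      have "poly_eval x (rename_vars p (F $ a)) = poly_eval (proj x) (F $ a)"
        by (rule poly_eval_rename_vars[OF bp]) (use F_vars[OF a] in \<open>auto simp: proj_def\<close>)
      then show "map_eval F (proj x) $ a = proj (map_eval E x) $ a"
        using a z by (simp add: map_eval_index[OF Fmap]) (simp add: proj_def map_eval_index[OF Emap] pn E_low)
    qed (use map_eval_carrier[OF Fmap, of "proj x"] in \<open>simp add: proj_def\<close>)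
    have "is_poly_automorphism z F"
    proof (rule poly_automorphismI[OF Fmap, where h = "\<lambda>a y. map_eval H (incl y) $ p a"])
      fix a assume a: "a < z"
      then have pa: "p a < n" using z by (simp add: pn)
      have "polynomial_function z (\<lambda>y. poly_eval (incl y) (H $ p a))"
      proof (rule polynomial_function_compose)
        fix i assume "i \<in> poly_vars (H $ p a)"
        then have "i < n" using H(1) pa by (auto simp: is_poly_map_def)
        then show "polynomial_function z (\<lambda>y. incl y $ i)"
          by (cases "?q i < z") (simp_all add: incl_def polynomial_function_coord polynomial_function_const)
      qed
      then show "polynomial_function z (\<lambda>y. map_eval H (incl y) $ p a)"
        unfolding map_eval_index[OF H(1) pa] .
    next
      fix x :: "complex vec" assume x: "x \<in> carrier_vec z"
      show "vec z (\<lambda>a. map_eval H (incl (map_eval F x)) $ p a) = x"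
        unfolding E_incl[symmetric] H(2)[OF incl] using proj_incl[OF x] by (simp add: proj_def)
    next
      fix y :: "complex vec" assume y: "y \<in> carrier_vec z"
      show "map_eval F (vec z (\<lambda>a. map_eval H (incl y) $ p a)) = y"
        using F_proj[of "map_eval H (incl y)"] proj_incl[OF y] unfolding H(3)[OF incl] by (simp add: proj_def)
    qed
    with F(2) show False ..
  qed
  with graded keller show ?thesis unfolding graded_keller_maps_def by blast
qed

section \<open>The correspondence with the Jacobian Conjecture\<close>

text \<open>A monomial that involves \<open>x\<^sub>0\<close> survives differentiation; as the derivative is constant, such a
  monomial can only be \<open>x\<^sub>0\<close> itself, and the map is affine.\<close>

lemma jacobian_conjecture_one: "jacobian_conjecture 1"
  unfolding jacobian_conjecture_def
proof (intro allI impI)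
  fix F assume "is_keller_map 1 F"
  then obtain c where c: "c \<noteq> 0" "det (jacobian 1 F) = Poly_Mapping.single 0 c" and F: "is_poly_map 1 F"
    unfolding is_keller_map_def by blast
  let ?p = "F $ 0" and ?e = "Poly_Mapping.single (0::nat) (1::nat)"
  define b where "b = Poly_Mapping.lookup ?p 0"
  have d: "partial_deriv 0 ?p = Poly_Mapping.single 0 c"
    using c(2) det_single[of "jacobian 1 F"] by (simp add: jacobian_def)
  have "Poly_Mapping.lookup (partial_deriv 0 ?p) 0 = c" unfolding d by simp
  then have ce: "Poly_Mapping.lookup ?p ?e = c" by (simp add: lookup_partial_deriv)
  have vars: "poly_vars ?p \<subseteq> {..<1}" using F by (simp add: is_poly_map_def)
  have support: "m = 0 \<or> m = ?e" if m: "m \<in> Poly_Mapping.keys ?p" for m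
  proof (cases "Poly_Mapping.lookup m 0 = 0")
    case True
    have "Poly_Mapping.keys m \<subseteq> {..<1}" using vars m unfolding poly_vars_subset_iff by (rule bspec)
    moreover have "0 \<notin> Poly_Mapping.keys m" using True by (simp only: in_keys_iff not_not)
    ultimately have "Poly_Mapping.keys m = {}" by (auto simp del: keys_eq_empty)
    then have "m = 0" by (simp only: keys_eq_empty)
    then show ?thesis ..
  next
    case False
    have split: "m - ?e + ?e = m"
    proof (rule poly_mapping_eqI)
      fix i
      show "Poly_Mapping.lookup (m - ?e + ?e) i = Poly_Mapping.lookup m i"
        using False by (cases "i = 0") (simp_all add: lookup_add lookup_minus lookup_single)
    qed
    then have "m - ?e \<in> Poly_Mapping.keys (partial_deriv 0 ?p)"
      using m unfolding keys_partial_deriv by simp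
    then have "m - ?e \<in> {0}" unfolding d using c(1) by simp
    then have "m - ?e + ?e = ?e" by simp
    with split show ?thesis by (metis (no_types))
  qed
  have p: "?p = Poly_Mapping.single 0 b + Poly_Mapping.single ?e c"
  proof (rule poly_mapping_eqI)
    fix m
    have "Poly_Mapping.lookup ?e 0 \<noteq> Poly_Mapping.lookup 0 (0::nat)" by simp
    then have e: "?e \<noteq> 0" by (rule contrapos_nn) (rule arg_cong)
    consider "m = 0" | "m = ?e" | "m \<noteq> 0" "m \<noteq> ?e" by blast
    then show "Poly_Mapping.lookup ?p m = Poly_Mapping.lookup (Poly_Mapping.single 0 b + Poly_Mapping.single ?e c) m"
    proof cases
      case 1
      show ?thesis unfolding 1 lookup_add by (simp only: lookup_single_eq lookup_single_not_eq[OF e] b_def add_0_right)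
    next
      case 2
      show ?thesis unfolding 2 lookup_add
        by (simp only: lookup_single_eq lookup_single_not_eq[OF e[symmetric]] ce add_0)
    next
      case 3
      then have "m \<notin> Poly_Mapping.keys ?p" using support by blast
      then have "Poly_Mapping.lookup ?p m = 0" by (simp only: in_keys_iff not_not)
      then show ?thesis unfolding lookup_add
        by (simp only: lookup_single_not_eq[OF 3(1)[symmetric]] lookup_single_not_eq[OF 3(2)[symmetric]] add_0)
    qed
  qed
  have eval: "map_eval F x $ 0 = b + c * x $ 0" for x
  proof -
    have "map_eval F x $ 0 = poly_eval x ?p" by (rule map_eval_index[OF F]) simp
    also have "\<dots> = poly_eval x (Poly_Mapping.single 0 b + Poly_Mapping.single ?e c)"
      by (rule arg_cong[OF p])
    also have "\<dots> = b + c * x $ 0" by (simp only: poly_eval_add poly_eval_single monomial_eval_single) simp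
    finally show ?thesis .
  qed
  show "is_poly_automorphism 1 F"
  proof (rule poly_automorphismI[OF F, where h = "\<lambda>j y. (y $ 0 - b) * (1 / c)"])
    show "polynomial_function 1 (\<lambda>y. (y $ 0 - b) * (1 / c))"
      by (intro polynomial_function_mult polynomial_function_diff polynomial_function_coord polynomial_function_const) simp
    show "vec 1 (\<lambda>j. (map_eval F x $ 0 - b) * (1 / c)) = x" if "x \<in> carrier_vec 1" for x
      using that c(1) by (intro eq_vecI) (auto simp: eval)
    show "map_eval F (vec 1 (\<lambda>j. (y $ 0 - b) * (1 / c))) = y" if "y \<in> carrier_vec 1" for y
      using that c(1) map_eval_carrier[OF F] by (intro eq_vecI) (auto simp: eval)
  qed
qed

lemma graded_keller_maps_uminus:
  assumes w: "w \<in> carrier_vec n"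
  shows "graded_keller_maps n (- w) = graded_keller_maps n w"
proof -
  have neg: "monomial_weight (- w) m = - monomial_weight w m" if "Poly_Mapping.keys m \<subseteq> {..<n}" for m
    unfolding monomial_weight_def sum_negf[symmetric]
    by (rule sum.cong) (use that w in auto)
  have "is_graded_map n (- w) G \<longleftrightarrow> is_graded_map n w G" for G
  proof -
    have "weight_homogeneous (- w) ((- w) $ j) (G $ j) \<longleftrightarrow> weight_homogeneous w (w $ j) (G $ j)"
      if G: "is_poly_map n G" and j: "j < n" for j
      unfolding weight_homogeneous_def
    proof (rule ball_cong)
      fix m assume "m \<in> Poly_Mapping.keys (G $ j)"
      moreover have "poly_vars (G $ j) \<subseteq> {..<n}" using G j by (simp add: is_poly_map_def)
      ultimately have "Poly_Mapping.keys m \<subseteq> {..<n}" unfolding poly_vars_subset_iff by blast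
      then show "monomial_weight (- w) m = (- w) $ j \<longleftrightarrow> monomial_weight w m = w $ j"
        using j w by (simp add: neg)
    qed simp
    then show ?thesis unfolding is_graded_map_def by auto
  qed
  then show ?thesis unfolding graded_keller_maps_def by simp
qed

lemma graded_keller_maps_nonneg:
  assumes w: "\<forall>i<n. 0 \<le> w $ i"
  shows "graded_keller_maps n w \<noteq> {} \<longleftrightarrow> \<not> jacobian_conjecture (card {i. i < n \<and> w $ i = 0})"
proof -
  let ?Z = "{i. i < n \<and> w $ i = 0}"
  define z where "z = card ?Z"
  have Z: "?Z \<subseteq> {..<n}" by auto
  have z: "z \<le> n" unfolding z_def using card_mono[OF _ Z] by simp
  obtain p where p: "p permutes {0..<n}" and pZ: "\<And>i. i < n \<Longrightarrow> p i \<in> ?Z \<longleftrightarrow> i < z"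
    using exists_permutation_onto[OF Z z_def[symmetric]] by blast
  have pz: "w $ p i = 0 \<longleftrightarrow> i < z" if "i < n" for i
    using pZ[OF that] permutes_in_image[OF p, of i] that by simp
  have "graded_keller_maps n w \<noteq> {}" if "\<not> jacobian_conjecture z"
    using that graded_keller_stabilization[OF _ _ p z pz] unfolding jacobian_conjecture_def by blast
  moreover have "graded_keller_maps n w = {}" if JC: "jacobian_conjecture z"
  proof -
    have "is_poly_automorphism n G" if G: "is_graded_map n w G" and K: "is_keller_map n G" for G
    proof -
      obtain c where c: "c \<noteq> 0" "det (jacobian n G) = Poly_Mapping.single 0 c"
        using K unfolding is_keller_map_def by blast
      have "is_keller_map z (vec z (\<lambda>a. rename_vars (inv_into UNIV p) (G $ p a)))"
        by (rule keller_weight_zero_part[OF w G c(2,1) p z pz])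
      then have "is_poly_automorphism z (vec z (\<lambda>a. rename_vars (inv_into UNIV p) (G $ p a)))"
        using JC unfolding jacobian_conjecture_def by blast
      then show ?thesis
        using graded_automorphism_if_weight_zero_part[OF w G c(2,1) p z] pz by blast
    qed
    then show ?thesis unfolding graded_keller_maps_def by blast
  qed
  ultimately show ?thesis unfolding z_def[symmetric] by blast
qed

theorem theorem10p2:
  fixes n z :: nat and w :: "int vec"
  assumes "w \<in> carrier_vec n" and "w \<noteq> 0\<^sub>v n"
    and "parabolic w"
    and "z = card {i. i < n \<and> w $ i = 0}"
    and "(\<forall>i<n. w $ i \<noteq> 0 \<longrightarrow> w $ i > 0) \<or> (\<forall>i<n. w $ i \<noteq> 0 \<longrightarrow> w $ i < 0)"
  shows "(graded_keller_classes n w \<noteq> {} \<longleftrightarrow> \<not> jacobian_conjecture z)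
       \<and> (z = 1 \<longrightarrow> graded_keller_classes n w = {})"
proof -
  have "graded_keller_maps n w \<noteq> {} \<longleftrightarrow> \<not> jacobian_conjecture z"
    using assms(5)
  proof
    assume "\<forall>i<n. w $ i \<noteq> 0 \<longrightarrow> w $ i > 0"
    then have "\<forall>i<n. 0 \<le> w $ i" by force
    then show ?thesis unfolding assms(4) by (rule graded_keller_maps_nonneg)
  next
    assume "\<forall>i<n. w $ i \<noteq> 0 \<longrightarrow> w $ i < 0"
    then have "\<forall>i<n. 0 \<le> (- w) $ i" using assms(1) by force
    moreover have "{i. i < n \<and> (- w) $ i = 0} = {i. i < n \<and> w $ i = 0}" using assms(1) by auto
    ultimately show ?thesis
      using graded_keller_maps_nonneg[of n "- w"] graded_keller_maps_uminus[OF assms(1)] assms(4) by simp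
  qed
  then have "graded_keller_classes n w \<noteq> {} \<longleftrightarrow> \<not> jacobian_conjecture z"
    unfolding graded_keller_classes_def quotient_def by simp
  then show ?thesis using jacobian_conjecture_one by blast
qed

end
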